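(* Assume that $H$ generates a holomorphic Hamiltonian $\mathbb{R}$-action, i.e. the Hamiltonian flow of $\xi_H$ preserves $J$. Let $z_c$ be a Morse critical point of $H$ and $E=H(z_c)$. Then the normalized pointwise spectral measure at $z_c$ is always a delta-function: $$\hat\mu_k^{z_c}:=\frac{1}{\Pi_k(z_c)}\sum_j\|s_{k,j}(z_c)\|^2\,\delta_{\mu_{k,j}}=\delta_{H(z_c)}$$ for all $k=1,2,\dots$ (for which $\Pi_k(z_c)\neq0$, so that the normalized measure is defined). Equivalently, for any spectral interval $I\subset\mathbb{R}$, $$\lim_{k\to\infty}\frac{\Pi_{k,I}(z_c)}{\Pi_k(z_c)}=\begin{cases}1,&E\in I,\\0,&E\notin I.\end{cases}$$
   Context: Setting. $(L,h)\to(M,\omega,J)$ is a polarized compact Kähler manifold of complex dimension $m$: $L$ is a positive Hermitian holomorphic line bundle with $\omega=-i\partial\bar\partial\log h$. $H^0(M,L^k)$ is the space of holomorphic sections of $L^k$, with the $L^2$ inner product defined by $h^k$ and the volume form $d\mathrm{Vol}_M=\omega^m/m!$; $\Pi_k:L^2(M,L^k)\to H^0(M,L^k)$ is the orthogonal projection. $H:M\to\mathbb{R}$ is a smooth function and $\xi_H$ is its Hamiltonian vector field, $dH(Y)=\omega(\xi_H,Y)$. The Berezin–Toeplitz quantization of $H$ is $\hat H_k=\Pi_k\circ(H+\frac{i}{k}\nabla_{\xi_H})\circ\Pi_k$ acting on $H^0(M,L^k)$, where $H$ acts by multiplication and $\nabla$ is the Chern connection on $L^k$; when $\xi_H$ preserves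 $J$ it reduces to the Kostant quantization $\hat H_k=\frac{i}{k}\nabla_{\xi_H}+H$. Its eigenvalues, repeated with multiplicity, are $\mu_{k,1}\le\dots\le\mu_{k,N_k}$, with corresponding orthonormal eigensections $s_{k,j}$. With $\|\cdot\|$ the pointwise norm of $h^k$, put $\Pi_k(z)=\sum_j\|s_{k,j}(z)\|^2$ and $\Pi_{k,I}(z)=\sum_{\mu_{k,j}\in I}\|s_{k,j}(z)\|^2$. $\delta_a$ denotes the Dirac measure at $a\in\mathbb{R}$. *)

theory Defs
  imports "HOL-Probability.Probability"
begin

section \<open>Calculus on open subsets of complex coordinate space\<close>

text \<open>
  Real tangent vectors of complex coordinate space are identified with elements of
  \<open>complex ^ 'm\<close> (the vector with components a + ib stands for the sum of
  a times the x-derivative and b times the y-derivative); the complex structure is then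
  multiplication by \<open>\<i>\<close>.
\<close>

definition J :: "complex ^ 'm \<Rightarrow> complex ^ 'm" where
  "J v = \<i> *s v"

abbreviation D :: "('a::real_normed_vector \<Rightarrow> 'b::real_normed_vector) \<Rightarrow> 'a \<Rightarrow> 'a \<Rightarrow> 'b" where
  "D f z \<equiv> frechet_derivative f (at z)"

text \<open>These two notions are only used for open \<open>S\<close>.\<close>

primrec C_k_on :: "nat \<Rightarrow> 'a::real_normed_vector set \<Rightarrow> ('a \<Rightarrow> 'b::real_normed_vector) \<Rightarrow> bool" where
  "C_k_on 0 S f \<longleftrightarrow> continuous_on S f"
| "C_k_on (Suc n) S f \<longleftrightarrow>
     (\<forall>z\<in>S. f differentiable (at z)) \<and> (\<forall>v. C_k_on n S (\<lambda>z. D f z v))"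

definition smooth_on :: "'a::real_normed_vector set \<Rightarrow> ('a \<Rightarrow> 'b::real_normed_vector) \<Rightarrow> bool" where
  "smooth_on S f \<longleftrightarrow> (\<forall>n. C_k_on n S f)"

definition holomorphic_fun_on :: "(complex ^ 'm::finite) set \<Rightarrow> (complex ^ 'm \<Rightarrow> complex) \<Rightarrow> bool" where
  "holomorphic_fun_on S f \<longleftrightarrow>
     (\<forall>z\<in>S. f differentiable (at z) \<and> (\<forall>v. D f z (J v) = \<i> * D f z v))"

definition holomorphic_map_on ::
    "(complex ^ 'm::finite) set \<Rightarrow> (complex ^ 'm \<Rightarrow> complex ^ 'm) \<Rightarrow> bool" where
  "holomorphic_map_on S f \<longleftrightarrow>
     (\<forall>z\<in>S. f differentiable (at z) \<and> (\<forall>v. D f z (J v) = J (D f z v)))"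

definition wirtinger :: "'m::finite \<Rightarrow> (complex ^ 'm \<Rightarrow> complex) \<Rightarrow> complex ^ 'm \<Rightarrow> complex" where
  "wirtinger j f z = (D f z (axis j 1) - \<i> * D f z (axis j \<i>)) / 2"

definition wirtinger_bar :: "'m::finite \<Rightarrow> (complex ^ 'm \<Rightarrow> complex) \<Rightarrow> complex ^ 'm \<Rightarrow> complex" where
  "wirtinger_bar j f z = (D f z (axis j 1) + \<i> * D f z (axis j \<i>)) / 2"

text \<open>The (1,0)-form \<open>\<partial>f\<close> and the (1,1)-form \<open>\<partial>\<partial>\<close>-bar \<open>f\<close>, evaluated on real tangent
  vectors; \<open>dz\<^sub>j \<and> dz\<^sub>l\<close>-bar applied to \<open>(u, v)\<close> is \<open>u\<^sub>j cnj v\<^sub>l - v\<^sub>j cnj u\<^sub>l\<close>.\<close>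

definition del :: "(complex ^ 'm::finite \<Rightarrow> complex) \<Rightarrow> complex ^ 'm \<Rightarrow> complex ^ 'm \<Rightarrow> complex" where
  "del f z v = (\<Sum>j\<in>UNIV. wirtinger j f z * v $ j)"

definition del_delbar ::
    "(complex ^ 'm::finite \<Rightarrow> complex) \<Rightarrow> complex ^ 'm \<Rightarrow> complex ^ 'm \<Rightarrow> complex ^ 'm \<Rightarrow> complex" where
  "del_delbar f z u v =
     (\<Sum>j\<in>UNIV. \<Sum>l\<in>UNIV. wirtinger j (wirtinger_bar l f) z * (u $ j * cnj (v $ l) - v $ j * cnj (u $ l)))"


section \<open>Compact complex manifolds\<close>

text \<open>
  The manifold is the whole (nonempty) type \<open>'p\<close>, of complex dimension \<open>CARD('m)\<close>.
  A chart is a pair of its domain and its coordinate map.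
\<close>

type_synonym ('p, 'm) chart = "'p set \<times> ('p \<Rightarrow> complex ^ 'm)"

abbreviation dom_ch :: "('p, 'm) chart \<Rightarrow> 'p set" where
  "dom_ch c \<equiv> fst c"

abbreviation coord :: "('p, 'm) chart \<Rightarrow> 'p \<Rightarrow> complex ^ 'm" where
  "coord c \<equiv> snd c"

definition param :: "('p, 'm) chart \<Rightarrow> complex ^ 'm \<Rightarrow> 'p" where
  "param c = inv_into (dom_ch c) (coord c)"

definition chart_at :: "('p, 'm) chart set \<Rightarrow> 'p \<Rightarrow> ('p, 'm) chart" where
  "chart_at A x = (SOME c. c \<in> A \<and> x \<in> dom_ch c)"

definition compact_complex_manifold :: "('p::t2_space, 'm::finite) chart set \<Rightarrow> bool" where
  "compact_complex_manifold A \<longleftrightarrow>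
     compact (UNIV :: 'p set) \<and>
     (\<Union>c\<in>A. dom_ch c) = UNIV \<and>
     (\<forall>c\<in>A. open (dom_ch c) \<and> open (coord c ` dom_ch c) \<and>
        homeomorphism (dom_ch c) (coord c ` dom_ch c) (coord c) (param c)) \<and>
     (\<forall>c\<in>A. \<forall>c'\<in>A. holomorphic_map_on (coord c ` (dom_ch c \<inter> dom_ch c')) (coord c' \<circ> param c))"

definition smooth_function :: "('p, 'm::finite) chart set \<Rightarrow> ('p \<Rightarrow> real) \<Rightarrow> bool" where
  "smooth_function A H \<longleftrightarrow> (\<forall>c\<in>A. smooth_on (coord c ` dom_ch c) (H \<circ> param c))"

text \<open>Vector fields and 2-forms are given by their coordinate expressions
  \<open>\<xi> c x\<close> and \<open>\<omega> c x u v\<close> in each chart \<open>c\<close> around \<open>x\<close>.\<close>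

type_synonym ('p, 'm) vfield = "('p, 'm) chart \<Rightarrow> 'p \<Rightarrow> complex ^ 'm"

type_synonym ('p, 'm) two_form = "('p, 'm) chart \<Rightarrow> 'p \<Rightarrow> complex ^ 'm \<Rightarrow> complex ^ 'm \<Rightarrow> real"

definition smooth_vector_field :: "('p, 'm::finite) chart set \<Rightarrow> ('p, 'm) vfield \<Rightarrow> bool" where
  "smooth_vector_field A \<xi> \<longleftrightarrow>
     (\<forall>c\<in>A. smooth_on (coord c ` dom_ch c) (\<xi> c \<circ> param c)) \<and>
     (\<forall>c\<in>A. \<forall>c'\<in>A. \<forall>x\<in>dom_ch c \<inter> dom_ch c'.
        \<xi> c' x = D (coord c' \<circ> param c) (coord c x) (\<xi> c x))"

definition morse_critical_point :: "('p, 'm::finite) chart set \<Rightarrow> ('p \<Rightarrow> real) \<Rightarrow> 'p \<Rightarrow> bool" where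
  "morse_critical_point A H z \<longleftrightarrow>
     (\<forall>c\<in>A. z \<in> dom_ch c \<longrightarrow>
        (\<forall>v. D (H \<circ> param c) (coord c z) v = 0) \<and>
        (\<forall>u. u \<noteq> 0 \<longrightarrow> (\<exists>v. D (\<lambda>w. D (H \<circ> param c) w u) (coord c z) v \<noteq> 0)))"


section \<open>Positive Hermitian holomorphic line bundles\<close>

text \<open>
  A holomorphic line bundle is given by an open cover over whose members there are holomorphic
  frames \<open>e\<^sub>i\<close>, and by the transition functions \<open>e\<^sub>j = g\<^sub>i\<^sub>j e\<^sub>i\<close>.  A Hermitian metric \<open>h\<close> is given by
  the positive functions \<open>h(e\<^sub>i, e\<^sub>i)\<close>, the field \<open>weight\<close>.
\<close>

record ('i, 'p) line_bundle =
  index :: "'i set"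
  triv :: "'i \<Rightarrow> 'p set"
  trans_fun :: "'i \<Rightarrow> 'i \<Rightarrow> 'p \<Rightarrow> complex"
  weight :: "'i \<Rightarrow> 'p \<Rightarrow> real"

definition hermitian_holomorphic_line_bundle ::
    "('p::t2_space, 'm::finite) chart set \<Rightarrow> ('i, 'p) line_bundle \<Rightarrow> bool" where
  "hermitian_holomorphic_line_bundle A L \<longleftrightarrow>
     (\<Union>i\<in>index L. triv L i) = UNIV \<and>
     (\<forall>i\<in>index L. open (triv L i)) \<and>
     (\<forall>i\<in>index L. \<forall>j\<in>index L. \<forall>x\<in>triv L i \<inter> triv L j. trans_fun L i j x \<noteq> 0) \<and>
     (\<forall>i\<in>index L. \<forall>j\<in>index L. \<forall>c\<in>A.
        holomorphic_fun_on (coord c ` (dom_ch c \<inter> triv L i \<inter> triv L j)) (trans_fun L i j \<circ> param c)) \<and>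
     (\<forall>i\<in>index L. \<forall>x\<in>triv L i. trans_fun L i i x = 1) \<and>
     (\<forall>i\<in>index L. \<forall>j\<in>index L. \<forall>l\<in>index L. \<forall>x\<in>triv L i \<inter> triv L j \<inter> triv L l.
        trans_fun L i j x * trans_fun L j l x = trans_fun L i l x) \<and>
     (\<forall>i\<in>index L. \<forall>x\<in>triv L i. weight L i x > 0) \<and>
     (\<forall>i\<in>index L. \<forall>c\<in>A. smooth_on (coord c ` (dom_ch c \<inter> triv L i)) (weight L i \<circ> param c)) \<and>
     (\<forall>i\<in>index L. \<forall>j\<in>index L. \<forall>x\<in>triv L i \<inter> triv L j.
        weight L j x = (cmod (trans_fun L i j x))\<^sup>2 * weight L i x)"

text \<open>The form \<open>\<omega>\<close> equals \<open>-\<i>\<partial>\<partial>\<close>-bar \<open>log h\<close> and is positive, i.e. \<open>\<omega>(\<cdot>, J\<cdot>)\<close> is a Riemannian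
  (hence Kaehler) metric.\<close>

definition polarized_kaehler_manifold ::
    "('p::t2_space, 'm::finite) chart set \<Rightarrow> ('i, 'p) line_bundle \<Rightarrow> ('p, 'm) two_form \<Rightarrow> bool" where
  "polarized_kaehler_manifold A L \<omega> \<longleftrightarrow>
     compact_complex_manifold A \<and>
     hermitian_holomorphic_line_bundle A L \<and>
     (\<forall>c\<in>A. \<forall>i\<in>index L. \<forall>x\<in>dom_ch c \<inter> triv L i. \<forall>u v.
        complex_of_real (\<omega> c x u v) =
          - \<i> * del_delbar (\<lambda>w. complex_of_real (ln (weight L i (param c w)))) (coord c x) u v) \<and>
     (\<forall>c\<in>A. \<forall>x\<in>dom_ch c. \<forall>u. u \<noteq> 0 \<longrightarrow> \<omega> c x u (J u) > 0)"

text \<open>The coordinate frame of real tangent vectors: \<open>(j, False)\<close> indexes the \<open>x\<^sub>j\<close>-derivative and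
  \<open>(j, True)\<close> the \<open>y\<^sub>j\<close>-derivative.\<close>

definition real_frame :: "'m::finite \<times> bool \<Rightarrow> complex ^ 'm" where
  "real_frame p = axis (fst p) (if snd p then \<i> else 1)"

text \<open>
  The value of the top degree form \<open>\<omega>\<^sup>m / m!\<close> on the positively oriented frame
  \<open>(x\<^sub>1, y\<^sub>1, \<dots>, x\<^sub>m, y\<^sub>m)\<close>: the m-fold wedge power of a 2-form is the alternating sum
  over all permutations of the 2m arguments, divided by \<open>2\<^sup>m\<close>.  Reordering the index type \<open>'m\<close>
  permutes pairs and does not affect the sign.
\<close>

definition volume_density :: "('p, 'm::finite) two_form \<Rightarrow> ('p, 'm) chart \<Rightarrow> 'p \<Rightarrow> real" where
  "volume_density \<omega> c x =
     (\<Sum>\<sigma> | \<sigma> permutes (UNIV :: ('m \<times> bool) set).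
        of_int (sign \<sigma>) *
        (\<Prod>j\<in>UNIV. \<omega> c x (real_frame (\<sigma> (j, False))) (real_frame (\<sigma> (j, True)))))
     / (2 ^ CARD('m) * fact CARD('m))"

text \<open>The (unique) Borel measure on the manifold defined by the volume form \<open>\<omega>\<^sup>m / m!\<close>.\<close>

definition liouville_measure ::
    "('p::t2_space, 'm::finite) chart set \<Rightarrow> ('p, 'm) two_form \<Rightarrow> 'p measure \<Rightarrow> bool" where
  "liouville_measure A \<omega> vol \<longleftrightarrow>
     sets vol = sets borel \<and>
     (\<forall>c\<in>A. \<forall>B\<in>sets borel. B \<subseteq> dom_ch c \<longrightarrow>
        emeasure vol B =
          (\<integral>\<^sup>+ w. ennreal (volume_density \<omega> c (param c w)) * indicator (coord c ` B) w \<partial>lborel))"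


section \<open>Sections of the k-th tensor power\<close>

text \<open>
  A section of \<open>L\<^sup>k\<close> is given by its coefficients \<open>s i\<close> with respect to the frames
  \<open>e\<^sub>i\<^sup>k\<close>, extended by 0 outside the trivializing set, so that equality of sections is equality
  of functions.
\<close>

type_synonym ('i, 'p) sec = "'i \<Rightarrow> 'p \<Rightarrow> complex"

definition is_section :: "('i, 'p) line_bundle \<Rightarrow> nat \<Rightarrow> ('i, 'p) sec \<Rightarrow> bool" where
  "is_section L k s \<longleftrightarrow>
     (\<forall>i\<in>index L. \<forall>j\<in>index L. \<forall>x\<in>triv L i \<inter> triv L j. s i x = trans_fun L i j x ^ k * s j x) \<and>
     (\<forall>i x. i \<notin> index L \<or> x \<notin> triv L i \<longrightarrow> s i x = 0)"

definition holomorphic_sections ::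
    "('p, 'm::finite) chart set \<Rightarrow> ('i, 'p) line_bundle \<Rightarrow> nat \<Rightarrow> ('i, 'p) sec set" where
  "holomorphic_sections A L k =
     {s. is_section L k s \<and>
         (\<forall>c\<in>A. \<forall>i\<in>index L. holomorphic_fun_on (coord c ` (dom_ch c \<inter> triv L i)) (s i \<circ> param c))}"

text \<open>The pointwise Hermitian product of \<open>h\<^sup>k\<close>; it does not depend on the chosen trivialization.\<close>

definition hprod :: "('i, 'p) line_bundle \<Rightarrow> nat \<Rightarrow> ('i, 'p) sec \<Rightarrow> ('i, 'p) sec \<Rightarrow> 'p \<Rightarrow> complex" where
  "hprod L k s t x =
     (let i = (SOME i. i \<in> index L \<and> x \<in> triv L i)
      in complex_of_real (weight L i x ^ k) * s i x * cnj (t i x))"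

definition hnorm :: "('i, 'p) line_bundle \<Rightarrow> nat \<Rightarrow> ('i, 'p) sec \<Rightarrow> 'p \<Rightarrow> real" where
  "hnorm L k s x = sqrt (Re (hprod L k s s x))"

definition L2_inner ::
    "('i, 'p) line_bundle \<Rightarrow> 'p measure \<Rightarrow> nat \<Rightarrow> ('i, 'p) sec \<Rightarrow> ('i, 'p) sec \<Rightarrow> complex" where
  "L2_inner L vol k s t = (\<integral>x. hprod L k s t x \<partial>vol)"

text \<open>The orthogonal projection onto the space of holomorphic sections.\<close>

definition szego_projection ::
    "('p, 'm::finite) chart set \<Rightarrow> ('i, 'p) line_bundle \<Rightarrow> 'p measure \<Rightarrow> nat \<Rightarrow> ('i, 'p) sec \<Rightarrow> ('i, 'p) sec"
  where
  "szego_projection A L vol k s =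
     (THE t. t \<in> holomorphic_sections A L k \<and>
        (\<forall>u\<in>holomorphic_sections A L k. L2_inner L vol k (\<lambda>i x. s i x - t i x) u = 0))"

text \<open>The Chern connection of \<open>(L\<^sup>k, h\<^sup>k)\<close>: in the holomorphic frame \<open>e\<^sub>i\<^sup>k\<close> it is
  \<open>\<nabla>(f e\<^sub>i\<^sup>k) = (df + f \<partial> log h\<^sub>i\<^sup>k) e\<^sub>i\<^sup>k\<close>.  The derivatives are computed in
  some chart around the point; the result does not depend on it.\<close>

definition chern_derivative ::
    "('p, 'm::finite) chart set \<Rightarrow> ('i, 'p) line_bundle \<Rightarrow> nat \<Rightarrow> ('p, 'm) vfield
      \<Rightarrow> ('i, 'p) sec \<Rightarrow> ('i, 'p) sec"
  where
  "chern_derivative A L k \<xi> s = (\<lambda>i x.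
     if i \<in> index L \<and> x \<in> triv L i
     then let c = chart_at A x
          in D (s i \<circ> param c) (coord c x) (\<xi> c x)
             + s i x * del (\<lambda>w. complex_of_real (ln (weight L i (param c w) ^ k))) (coord c x) (\<xi> c x)
     else 0)"


section \<open>Hamiltonian actions and quantization\<close>

definition hamiltonian_vector_field ::
    "('p, 'm::finite) chart set \<Rightarrow> ('p, 'm) two_form \<Rightarrow> ('p \<Rightarrow> real) \<Rightarrow> ('p, 'm) vfield \<Rightarrow> bool" where
  "hamiltonian_vector_field A \<omega> H \<xi> \<longleftrightarrow>
     smooth_vector_field A \<xi> \<and>
     (\<forall>c\<in>A. \<forall>x\<in>dom_ch c. \<forall>Y. D (H \<circ> param c) (coord c x) Y = \<omega> c x (\<xi> c x) Y)"

text \<open>The flow of \<open>\<xi>\<close>: the smooth action of the real line with infinitesimal generator \<open>\<xi>\<close>.\<close>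

definition flow_of ::
    "('p::t2_space, 'm::finite) chart set \<Rightarrow> ('p, 'm) vfield \<Rightarrow> (real \<Rightarrow> 'p \<Rightarrow> 'p) \<Rightarrow> bool" where
  "flow_of A \<xi> \<Phi> \<longleftrightarrow>
     \<Phi> 0 = id \<and>
     (\<forall>s t. \<Phi> (s + t) = \<Phi> s \<circ> \<Phi> t) \<and>
     continuous_on UNIV (\<lambda>(t, x). \<Phi> t x) \<and>
     (\<forall>c\<in>A. \<forall>c'\<in>A.
        smooth_on {(t, w). w \<in> coord c ` dom_ch c \<and> \<Phi> t (param c w) \<in> dom_ch c'}
          (\<lambda>(t, w). coord c' (\<Phi> t (param c w)))) \<and>
     (\<forall>c\<in>A. \<forall>t x. \<Phi> t x \<in> dom_ch c \<longrightarrow>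
        ((\<lambda>\<tau>. coord c (\<Phi> \<tau> x)) has_vector_derivative \<xi> c (\<Phi> t x)) (at t))"

definition preserves_J :: "('p, 'm::finite) chart set \<Rightarrow> ('p \<Rightarrow> 'p) \<Rightarrow> bool" where
  "preserves_J A F \<longleftrightarrow>
     (\<forall>c\<in>A. \<forall>c'\<in>A. \<forall>x\<in>dom_ch c. F x \<in> dom_ch c' \<longrightarrow>
        (\<forall>v. D (coord c' \<circ> F \<circ> param c) (coord c x) (J v)
             = J (D (coord c' \<circ> F \<circ> param c) (coord c x) v)))"

definition holomorphic_R_action_generator ::
    "('p::t2_space, 'm::finite) chart set \<Rightarrow> ('p, 'm) vfield \<Rightarrow> bool" where
  "holomorphic_R_action_generator A \<xi> \<longleftrightarrow> (\<exists>\<Phi>. flow_of A \<xi> \<Phi> \<and> (\<forall>t. preserves_J A (\<Phi> t)))"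

definition toeplitz ::
    "('p, 'm::finite) chart set \<Rightarrow> ('i, 'p) line_bundle \<Rightarrow> 'p measure \<Rightarrow> ('p \<Rightarrow> real) \<Rightarrow> ('p, 'm) vfield
      \<Rightarrow> nat \<Rightarrow> ('i, 'p) sec \<Rightarrow> ('i, 'p) sec"
  where
  "toeplitz A L vol H \<xi> k s =
     (let t = szego_projection A L vol k s
      in szego_projection A L vol k
           (\<lambda>i x. complex_of_real (H x) * t i x + \<i> / of_nat k * chern_derivative A L k \<xi> t i x))"

text \<open>\<open>s 1, \<dots>, s N\<close> is an orthonormal basis of the space of holomorphic sections of \<open>L\<^sup>k\<close> consisting of
  eigensections of the quantization of \<open>H\<close>, with eigenvalues \<open>\<mu> 1 \<le> \<dots> \<le> \<mu> N\<close>.\<close>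

definition eigenbasis ::
    "('p, 'm::finite) chart set \<Rightarrow> ('i, 'p) line_bundle \<Rightarrow> 'p measure \<Rightarrow> ('p \<Rightarrow> real) \<Rightarrow> ('p, 'm) vfield
      \<Rightarrow> nat \<Rightarrow> nat \<Rightarrow> (nat \<Rightarrow> real) \<Rightarrow> (nat \<Rightarrow> ('i, 'p) sec) \<Rightarrow> bool"
  where
  "eigenbasis A L vol H \<xi> k N \<mu> s \<longleftrightarrow>
     (\<forall>j\<in>{1..N}. s j \<in> holomorphic_sections A L k) \<and>
     (\<forall>j\<in>{1..N}. \<forall>l\<in>{1..N}. L2_inner L vol k (s j) (s l) = (if j = l then 1 else 0)) \<and>
     (\<forall>t\<in>holomorphic_sections A L k. \<exists>a :: nat \<Rightarrow> complex. t = (\<lambda>i x. \<Sum>j=1..N. a j * s j i x)) \<and>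
     (\<forall>j\<in>{1..N}. toeplitz A L vol H \<xi> k (s j) = (\<lambda>i x. complex_of_real (\<mu> j) * s j i x)) \<and>
     mono_on {1..N} \<mu>"

definition bergman ::
    "('i, 'p) line_bundle \<Rightarrow> nat \<Rightarrow> nat \<Rightarrow> (nat \<Rightarrow> ('i, 'p) sec) \<Rightarrow> 'p \<Rightarrow> real" where
  "bergman L k N s z = (\<Sum>j=1..N. (hnorm L k (s j) z)\<^sup>2)"

definition partial_bergman ::
    "('i, 'p) line_bundle \<Rightarrow> nat \<Rightarrow> nat \<Rightarrow> (nat \<Rightarrow> real) \<Rightarrow> (nat \<Rightarrow> ('i, 'p) sec) \<Rightarrow> real set \<Rightarrow> 'p \<Rightarrow> real"
  where
  "partial_bergman L k N \<mu> s I z = (\<Sum>j | j \<in> {1..N} \<and> \<mu> j \<in> I. (hnorm L k (s j) z)\<^sup>2)"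

text \<open>The weighted sum of the Dirac measures \<open>return borel (\<mu> j)\<close>.\<close>

definition pointwise_spectral_measure ::
    "('i, 'p) line_bundle \<Rightarrow> nat \<Rightarrow> nat \<Rightarrow> (nat \<Rightarrow> real) \<Rightarrow> (nat \<Rightarrow> ('i, 'p) sec) \<Rightarrow> 'p \<Rightarrow> real measure"
  where
  "pointwise_spectral_measure L k N \<mu> s z =
     measure_of UNIV (sets borel)
       (\<lambda>B. \<Sum>j=1..N. ennreal ((hnorm L k (s j) z)\<^sup>2 / bergman L k N s z) * emeasure (return borel (\<mu> j)) B)"

end

theory Submission
  imports Defs "HOL-Complex_Analysis.Complex_Analysis"
begin

text \<open>
  Write
  \<open>Q s = H s + (\<i>/k) \<nabla>\<^sub>\<xi> s\<close> for the Kostant operator.  At a critical point of \<open>H\<close> the Hamiltonian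
  vector field vanishes, because \<open>dH = \<omega>(\<xi>, \<cdot>)\<close> and \<open>\<omega>\<close> is nondegenerate; there the covariant derivative
  drops out and \<open>(Q s)(z) = H(z) s(z)\<close>.  So an eigensection of \<open>Q\<close> with eigenvalue \<open>\<mu>\<close> satisfies
  \<open>(\<mu> - H(z)) s(z) = 0\<close>: every eigensection with an eigenvalue other than \<open>H(z)\<close> vanishes at \<open>z\<close>, and the
  whole mass of the spectral measure sits at \<open>H(z)\<close>.  This is exact for each \<open>k\<close>, so the limit along
  spectral intervals is the limit of an eventually constant sequence.

  The Toeplitz operator is \<open>Q\<close> between two orthogonal projections.  To replace it by \<open>Q\<close> one has to know
  that \<open>Q\<close> maps holomorphic sections to holomorphic sections (\<open>kostant_holomorphic\<close>).  In a chart and a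
  holomorphic frame, with \<open>\<phi> = log h\<close>,
  \<open>Q f = (H + \<i> \<partial>\<phi>(\<xi>)) f + (\<i>/k) df(\<xi>)\<close>.
  The last term is holomorphic because \<open>df\<close> is holomorphic (Cauchy's integral formula,
  \<open>holomorphic_fun_on_D\<close>) and because \<open>\<xi>\<close> is: the flow is holomorphic for all times, and its time derivative
  inherits this by the symmetry of second derivatives (\<open>holomorphic_generator\<close>).  In the first term the
  factor is holomorphic because \<open>\<omega> = -\<i>\<partial>\<partial>\<close>-bar \<open>\<phi>\<close> makes the (0,1)-part of
  \<open>dH = \<omega>(\<xi>, \<cdot>)\<close> cancel the (0,1)-part of the differential of \<open>\<i> \<partial>\<phi>(\<xi>)\<close> (\<open>moment_map_holomorphic\<close>).

  The projection fixes holomorphic sections as soon as it is well defined on them, that is, as soon as a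
  holomorphic section is determined by its inner products with holomorphic sections.  An orthonormal basis
  gives this by comparison of coefficients (\<open>szego_projection_holomorphic\<close>).
\<close>

section \<open>Derivatives and the symmetry of second derivatives\<close>

lemma D_has_derivative:
  "f differentiable (at z) \<Longrightarrow> (f has_derivative D f z) (at z)"
  by (simp add: frechet_derivative_works)

lemma D_eqI: "(f has_derivative f') (at z) \<Longrightarrow> D f z = f'"
  by (metis frechet_derivative_at)

lemma D_linear: "f differentiable (at z) \<Longrightarrow> linear (D f z)"
  using D_has_derivative has_derivative_linear by blast

lemma D_cong_open:
  assumes "open S" "z \<in> S" "\<And>w. w \<in> S \<Longrightarrow> f w = g w"
  shows "D f z = D g z" "f differentiable (at z) \<longleftrightarrow> g differentiable (at z)"
proof -
  have "(f has_derivative f') (at z) \<longleftrightarrow> (g has_derivative f') (at z)" for f'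
    using assms has_derivative_transform_within_open by (metis (no_types, lifting))
  then show "D f z = D g z" "f differentiable (at z) \<longleftrightarrow> g differentiable (at z)"
    by (simp_all add: frechet_derivative_def differentiable_def)
qed

lemma D_bounded_linear_compose:
  assumes "bounded_linear h" "f differentiable (at z)"
  shows "(\<lambda>w. h (f w)) differentiable (at z)" "D (\<lambda>w. h (f w)) z v = h (D f z v)"
proof -
  have *: "((\<lambda>w. h (f w)) has_derivative (\<lambda>v. h (D f z v))) (at z)"
    by (rule bounded_linear.has_derivative[OF assms(1) D_has_derivative[OF assms(2)]])
  show "(\<lambda>w. h (f w)) differentiable (at z)" "D (\<lambda>w. h (f w)) z v = h (D f z v)"
    using * differentiable_def D_eqI[OF *] by auto
qed

text \<open>
  The second difference of \<open>f\<close> is the increment over \<open>[0,1]\<close> of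
  \<open>s \<mapsto> f (z + s t u + t v) - f (z + s t u)\<close>.  By the mean value theorem it is \<open>t\<close> times an increment of
  \<open>w \<mapsto> D f w u\<close>, which is controlled by the derivative of that map at the single point \<open>z\<close>.
\<close>

lemma second_difference_limit:
  fixes f :: "'a::real_normed_vector \<Rightarrow> real"
  assumes S: "open S" "z \<in> S" and f: "\<And>w. w \<in> S \<Longrightarrow> f differentiable (at w)"
    and u: "(\<lambda>w. D f w u) differentiable (at z)"
  shows "((\<lambda>t. (f (z + t *\<^sub>R u + t *\<^sub>R v) - f (z + t *\<^sub>R u) - f (z + t *\<^sub>R v) + f z) / t\<^sup>2)
           \<longlongrightarrow> D (\<lambda>w. D f w u) z v) (at_right 0)"
proof (rule tendstoI)
  fix e :: real assume e: "e > 0"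
  define G where "G = (\<lambda>w. D f w u)"
  define G' where "G' = D G z"
  have G: "(G has_derivative G') (at z)"
    unfolding G'_def by (rule D_has_derivative) (use u in \<open>simp add: G_def\<close>)
  have linG: "linear G'" using G has_derivative_linear by blast
  define C where "C = norm u + norm v + 1"
  have C: "C > 0" by (simp add: C_def add_nonneg_pos)
  \<comment> \<open>Two remainders, each at most e' t C, enter below; their sum has to stay below e t.\<close>
  define e' where "e' = e / (4 * C)"
  have e': "e' > 0" using e C by (simp add: e'_def)
  obtain d1 where d1: "d1 > 0" "\<And>y. norm (y - z) < d1 \<Longrightarrow> norm (G y - G z - G' (y - z)) \<le> e' * norm (y - z)"
    using G e' unfolding has_derivative_at_alt by blast
  obtain d2 where d2: "d2 > 0" "ball z d2 \<subseteq> S" using S open_contains_ball by blast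
  define d where "d = min d1 d2 / C"
  have d: "d > 0" using d1 d2 C by (simp add: d_def)
  have main: "dist ((f (z + t *\<^sub>R u + t *\<^sub>R v) - f (z + t *\<^sub>R u) - f (z + t *\<^sub>R v) + f z) / t\<^sup>2) (G' v) < e"
    if t: "0 < t" "t < d" for t
  proof -
    have tC: "t * C < d1" "t * C < d2"
      using t C by (auto simp: d_def pos_less_divide_eq)
    have nb: "norm ((s * t) *\<^sub>R u + r *\<^sub>R v) < t * C \<and> norm ((s * t) *\<^sub>R u + r *\<^sub>R v) \<le> t * C"
      if "0 \<le> s" "s \<le> 1" "0 \<le> r" "r \<le> t" for s r
    proof -
      have "norm ((s * t) *\<^sub>R u + r *\<^sub>R v) \<le> s * t * norm u + r * norm v"
        using norm_triangle_ineq[of "(s * t) *\<^sub>R u" "r *\<^sub>R v"] that t by simp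
      also have "\<dots> \<le> t * norm u + t * norm v"
        using that t by (intro add_mono mult_right_mono) (auto simp: mult_left_le_one_le)
      also have "\<dots> < t * C" using t by (simp add: C_def algebra_simps)
      finally show ?thesis by simp
    qed
    have inS: "z + (s * t) *\<^sub>R u + r *\<^sub>R v \<in> S" if "0 \<le> s" "s \<le> 1" "0 \<le> r" "r \<le> t" for s r
    proof -
      have "dist z (z + (s * t) *\<^sub>R u + r *\<^sub>R v) < d2"
        using nb[OF that] tC by (simp add: dist_norm add.assoc norm_minus_commute flip: minus_add_distrib)
      then show ?thesis using d2 by auto
    qed
    have est: "norm (G (z + (s * t) *\<^sub>R u + r *\<^sub>R v) - G z - G' ((s * t) *\<^sub>R u + r *\<^sub>R v)) \<le> e' * (t * C)"
      if "0 \<le> s" "s \<le> 1" "0 \<le> r" "r \<le> t" for s r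
    proof -
      have n: "norm ((z + (s * t) *\<^sub>R u + r *\<^sub>R v) - z) < t * C" using nb[OF that] by (simp add: add.assoc)
      then have "norm (G (z + (s * t) *\<^sub>R u + r *\<^sub>R v) - G z - G' ((z + (s * t) *\<^sub>R u + r *\<^sub>R v) - z))
          \<le> e' * norm ((z + (s * t) *\<^sub>R u + r *\<^sub>R v) - z)"
        using tC by (intro d1(2)) auto
      also have "\<dots> \<le> e' * (t * C)" using n e' by (intro mult_left_mono) auto
      finally show ?thesis by (simp add: add.assoc)
    qed
    define p where "p = (\<lambda>s. f (z + (s * t) *\<^sub>R u + t *\<^sub>R v) - f (z + (s * t) *\<^sub>R u))"
    have der: "((\<lambda>s. f (z + (s * t) *\<^sub>R u + r *\<^sub>R v)) has_derivative
                 (\<lambda>h. h * (t * G (z + (s * t) *\<^sub>R u + r *\<^sub>R v)))) (at s)"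
      if sr: "0 \<le> s" "s \<le> 1" "0 \<le> r" "r \<le> t" for s r
    proof -
      have 1: "((\<lambda>s. z + (s * t) *\<^sub>R u + r *\<^sub>R v) has_derivative (\<lambda>h. (h * t) *\<^sub>R u)) (at s)"
        by (auto intro!: derivative_eq_intros)
      have 2: "(f has_derivative D f (z + (s * t) *\<^sub>R u + r *\<^sub>R v)) (at (z + (s * t) *\<^sub>R u + r *\<^sub>R v))"
        by (rule D_has_derivative[OF f[OF inS[OF sr]]])
      have lin: "linear (D f (z + (s * t) *\<^sub>R u + r *\<^sub>R v))" by (rule D_linear[OF f[OF inS[OF sr]]])
      have 3: "((\<lambda>s. f (z + (s * t) *\<^sub>R u + r *\<^sub>R v)) has_derivative
             (\<lambda>h. D f (z + (s * t) *\<^sub>R u + r *\<^sub>R v) ((h * t) *\<^sub>R u))) (at s)"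
        by (rule has_derivative_compose[OF 1 2])
      show ?thesis
        by (rule has_derivative_eq_rhs[OF 3]) (simp add: G_def linear_scale[OF lin] mult.assoc)
    qed
    have pder: "(p has_derivative (\<lambda>h. h * (t * (G (z + (s * t) *\<^sub>R u + t *\<^sub>R v) - G (z + (s * t) *\<^sub>R u)))))
        (at s within {0..1})" if "0 \<le> s" "s \<le> 1" for s
      unfolding p_def
      by (rule has_derivative_at_withinI, rule has_derivative_eq_rhs,
          rule has_derivative_diff[OF der[of s t] der[of s 0, simplified]])
         (use that t in \<open>auto simp: algebra_simps\<close>)
    obtain s where s: "s \<in> {0<..<1}"
      "p 1 - p 0 = (1 - 0) * (t * (G (z + (s * t) *\<^sub>R u + t *\<^sub>R v) - G (z + (s * t) *\<^sub>R u)))"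
      using mvt_simple[of 0 1 p, OF _ pder] by auto
    have lhs: "p 1 - p 0 = f (z + t *\<^sub>R u + t *\<^sub>R v) - f (z + t *\<^sub>R u) - f (z + t *\<^sub>R v) + f z"
      by (simp add: p_def)
    define R1 where "R1 = G (z + (s * t) *\<^sub>R u + t *\<^sub>R v) - G z - G' ((s * t) *\<^sub>R u + t *\<^sub>R v)"
    define R2 where "R2 = G (z + (s * t) *\<^sub>R u) - G z - G' ((s * t) *\<^sub>R u)"
    have R: "\<bar>R1\<bar> \<le> e' * (t * C)" "\<bar>R2\<bar> \<le> e' * (t * C)"
      using est[of s t] est[of s 0] s t by (auto simp: R1_def R2_def)
    have "p 1 - p 0 = t * (t * G' v + (R1 - R2))"
      using s by (simp add: R1_def R2_def linear_add[OF linG] linear_scale[OF linG])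
    then have "(p 1 - p 0) / t\<^sup>2 - G' v = t * (t * G' v + (R1 - R2)) / t\<^sup>2 - G' v"
      by simp
    also have "\<dots> = (R1 - R2) / t"
      using t by (simp add: field_simps power2_eq_square)
    finally have "(p 1 - p 0) / t\<^sup>2 - G' v = (R1 - R2) / t" .
    moreover have "\<bar>(R1 - R2) / t\<bar> \<le> 2 * e' * C"
      using R t by (simp add: abs_divide pos_divide_le_eq abs_le_iff algebra_simps)
    moreover have "2 * e' * C < e" using e C by (simp add: e'_def)
    ultimately show ?thesis by (simp add: dist_real_def lhs)
  qed
  show "\<forall>\<^sub>F t in at_right 0. dist ((f (z + t *\<^sub>R u + t *\<^sub>R v) - f (z + t *\<^sub>R u) - f (z + t *\<^sub>R v) + f z) / t\<^sup>2)
      (D (\<lambda>w. D f w u) z v) < e"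
    unfolding eventually_at_right_field using main d by (auto simp: G'_def G_def intro!: exI[of _ d])
qed

text \<open>
  The second difference quotient is symmetric in \<open>u\<close> and \<open>v\<close>, hence so is its limit.
\<close>

lemma symmetric_second_derivative:
  fixes f :: "'a::real_normed_vector \<Rightarrow> 'b::euclidean_space"
  assumes S: "open S" "z \<in> S" and f: "\<And>w. w \<in> S \<Longrightarrow> f differentiable (at w)"
    and uv: "(\<lambda>w. D f w u) differentiable (at z)" "(\<lambda>w. D f w v) differentiable (at z)"
  shows "D (\<lambda>w. D f w u) z v = D (\<lambda>w. D f w v) z u"
proof (rule euclidean_eqI)
  fix b :: 'b assume "b \<in> Basis"
  have bl: "bounded_linear (\<lambda>x::'b. x \<bullet> b)" by (rule bounded_linear_inner_left)
  have comp: "(\<lambda>w. D (\<lambda>w. f w \<bullet> b) w u) differentiable (at z)"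
      "D (\<lambda>w. D (\<lambda>w. f w \<bullet> b) w u) z v = D (\<lambda>w. D f w u) z v \<bullet> b"
    if u: "(\<lambda>w. D f w u) differentiable (at z)" for u v
  proof -
    have *: "D (\<lambda>w. f w \<bullet> b) w u = D f w u \<bullet> b" if "w \<in> S" for w
      by (rule D_bounded_linear_compose(2)[OF bl f[OF that]])
    show "(\<lambda>w. D (\<lambda>w. f w \<bullet> b) w u) differentiable (at z)"
      "D (\<lambda>w. D (\<lambda>w. f w \<bullet> b) w u) z v = D (\<lambda>w. D f w u) z v \<bullet> b"
      using D_cong_open[OF S *] D_bounded_linear_compose[OF bl u] by auto
  qed
  have fb: "(\<lambda>w. f w \<bullet> b) differentiable (at w)" if "w \<in> S" for w
    by (rule D_bounded_linear_compose(1)[OF bl f[OF that]])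
  have "D (\<lambda>w. D (\<lambda>w. f w \<bullet> b) w u) z v = D (\<lambda>w. D (\<lambda>w. f w \<bullet> b) w v) z u"
    using second_difference_limit[OF S fb comp(1)[OF uv(1)], of v]
      second_difference_limit[OF S fb comp(1)[OF uv(2)], of u]
    by (intro tendsto_unique[of "at_right (0::real)"]) (auto simp: add_ac algebra_simps)
  then show "D (\<lambda>w. D f w u) z v \<bullet> b = D (\<lambda>w. D f w v) z u \<bullet> b"
    using comp(2) uv by simp
qed

text \<open>
  The product rule for a differential evaluated on a vector field; the expansion of the field in a basis
  reduces it to the maps \<open>w \<mapsto> D f w b\<close> with constant \<open>b\<close>.
\<close>

lemma has_derivative_D_along:
  fixes f :: "'a::euclidean_space \<Rightarrow> 'b::real_normed_vector"
  assumes S: "open S" "z \<in> S" and f: "\<And>w. w \<in> S \<Longrightarrow> f differentiable (at w)"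
    and f2: "\<And>v. (\<lambda>w. D f w v) differentiable (at z)"
    and X: "X differentiable (at z)"
  shows "((\<lambda>w. D f w (X w)) has_derivative (\<lambda>v. D (\<lambda>w. D f w (X z)) z v + D f z (D X z v))) (at z)"
proof -
  have exp: "D f w x = (\<Sum>b\<in>Basis. (x \<bullet> b) *\<^sub>R D f w b)" if "w \<in> S" for w x
  proof -
    have "D f w x = D f w (\<Sum>b\<in>Basis. (x \<bullet> b) *\<^sub>R b)" by (simp add: euclidean_representation)
    also have "\<dots> = (\<Sum>b\<in>Basis. (x \<bullet> b) *\<^sub>R D f w b)"
      using D_linear[OF f[OF that]] by (simp add: linear_sum linear_scale)
    finally show ?thesis .
  qed
  have der: "((\<lambda>w. \<Sum>b\<in>Basis. (Y w \<bullet> b) *\<^sub>R D f w b) has_derivative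
      (\<lambda>v. \<Sum>b\<in>Basis. (Y z \<bullet> b) *\<^sub>R D (\<lambda>w. D f w b) z v + (D Y z v \<bullet> b) *\<^sub>R D f z b)) (at z)"
    if Y: "Y differentiable (at z)" for Y
    by (intro has_derivative_sum has_derivative_scaleR D_has_derivative[OF f2]
        bounded_linear.has_derivative[OF bounded_linear_inner_left D_has_derivative[OF Y]])
  have der': "((\<lambda>w. D f w (Y w)) has_derivative
      (\<lambda>v. \<Sum>b\<in>Basis. (Y z \<bullet> b) *\<^sub>R D (\<lambda>w. D f w b) z v + (D Y z v \<bullet> b) *\<^sub>R D f z b)) (at z)"
    if Y: "Y differentiable (at z)" for Y
    by (rule has_derivative_transform_within_open[OF der[OF Y] S]) (simp add: exp)
  \<comment> \<open>The case of a constant field identifies the first summand.\<close>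
  have c: "D (\<lambda>w. D f w (X z)) z v = (\<Sum>b\<in>Basis. (X z \<bullet> b) *\<^sub>R D (\<lambda>w. D f w b) z v)" for v
    using D_eqI[OF der'[of "\<lambda>w. X z"]] by simp
  show ?thesis
    by (rule has_derivative_eq_rhs[OF der'[OF X]])
       (simp add: c sum.distrib exp[OF S(2), of "D X z _"])
qed

section \<open>Holomorphic functions of several variables\<close>

lemma J_J: "J (J v) = - v"
  by (simp add: J_def vec_eq_iff)

lemma vector_smult_eq_J: "\<zeta> *s v = Re \<zeta> *\<^sub>R v + Im \<zeta> *\<^sub>R J v"
  by (auto simp: J_def vec_eq_iff complex_eq_iff)

lemma bounded_linear_J: "bounded_linear (J :: complex ^ 'm::finite \<Rightarrow> _)"
  by (intro linear_conv_bounded_linear[THEN iffD1] linearI) (auto simp: J_def vec_eq_iff algebra_simps)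

lemma bounded_linear_vector_smult: "bounded_linear (\<lambda>\<zeta>::complex. \<zeta> *s (v :: complex ^ 'm::finite))"
  by (intro linear_conv_bounded_linear[THEN iffD1] linearI) (auto simp: vec_eq_iff algebra_simps)

lemma norm_vector_smult: "norm (\<zeta> *s (v :: complex ^ 'm::finite)) = norm \<zeta> * norm v"
  by (simp add: norm_vec_def norm_mult L2_set_right_distrib)

lemma D_smult_of_J_linear:
  assumes "f differentiable (at z)" "\<And>v. D f z (J v) = \<i> * D f z v"
  shows "D f z (\<zeta> *s v) = \<zeta> * D f z v"
proof -
  have "D f z (\<zeta> *s v) = Re \<zeta> *\<^sub>R D f z v + Im \<zeta> *\<^sub>R D f z (J v)"
    using D_linear[OF assms(1)] by (simp add: vector_smult_eq_J linear_add linear_scale)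
  then show ?thesis by (simp add: assms(2) complex_eq_iff)
qed

lemma circlepath_around_0: "r > 0 \<Longrightarrow> circlepath 0 r t \<noteq> 0" "r > 0 \<Longrightarrow> norm (circlepath 0 r t) = r"
  by (auto simp: circlepath norm_mult)

text \<open>
  The restriction of \<open>f\<close> to the complex line through \<open>z\<close> in the direction \<open>v\<close> is a holomorphic function of one
  variable, with derivative \<open>D f z v\<close> at the origin.  Cauchy's formula for this derivative involves only values
  of \<open>f\<close>, so that the dependence on \<open>z\<close> can be studied under the integral.
\<close>

lemma D_cauchy_integral:
  fixes f :: "complex ^ 'm::finite \<Rightarrow> complex"
  assumes f: "holomorphic_fun_on S f" and r: "r > 0" and S: "\<And>\<zeta>. norm \<zeta> \<le> r \<Longrightarrow> z + \<zeta> *s v \<in> S"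
  shows "D f z v = integral (cbox 0 1) (\<lambda>t::real. f (z + circlepath 0 r t *s v) / circlepath 0 r t)"
proof -
  define g where "g = (\<lambda>\<zeta>. f (z + \<zeta> *s v))"
  have der: "(g has_field_derivative D f (z + \<zeta> *s v) v) (at \<zeta>)" if "norm \<zeta> \<le> r" for \<zeta>
  proof -
    have 1: "((\<lambda>\<zeta>. z + \<zeta> *s v) has_derivative (\<lambda>h. h *s v)) (at \<zeta>)"
      using has_derivative_add[OF has_derivative_const bounded_linear_imp_has_derivative[OF bounded_linear_vector_smult[of v]]]
      by simp
    have d: "f differentiable (at (z + \<zeta> *s v))" "\<And>w. D f (z + \<zeta> *s v) (J w) = \<i> * D f (z + \<zeta> *s v) w"
      using f S[OF that] by (auto simp: holomorphic_fun_on_def)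
    show ?thesis
      using has_derivative_compose[OF 1 D_has_derivative[OF d(1)]] D_smult_of_J_linear[OF d]
      by (simp add: has_field_derivative_def g_def mult.commute[of _ "D f (z + \<zeta> *s v) v"] )
  qed
  have cont: "continuous_on (cball 0 r) g"
    by (intro continuous_at_imp_continuous_on ballI DERIV_isCont[OF der]) simp
  have hol: "g holomorphic_on ball 0 r"
    unfolding holomorphic_on_open[OF open_ball]
  proof
    fix x :: complex assume "x \<in> ball 0 r"
    then show "\<exists>f'. (g has_field_derivative f') (at x)" using der[of x] by auto
  qed
  have vd: "vector_derivative (circlepath 0 r) (at t) = 2 * of_real pi * \<i> * circlepath 0 r t" for t
    unfolding vector_derivative_circlepath by (simp add: circlepath)
  have "(g has_field_derivative (1 / (2 * of_real pi * \<i>) * contour_integral (circlepath 0 r) (\<lambda>u. g u / (u-0)^2))) (at 0)"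
    by (rule Cauchy_derivative_integral_circlepath(2)[OF cont hol]) (use r in simp)
  then have "D f z v = 1 / (2 * of_real pi * \<i>) * contour_integral (circlepath 0 r) (\<lambda>u. g u / u^2)"
    using DERIV_unique[OF der[of 0]] r by simp
  also have "\<dots> = integral {0..1} (\<lambda>t. 1 / (2 * of_real pi * \<i>) *
     (g (circlepath 0 r t) / (circlepath 0 r t)^2 * vector_derivative (circlepath 0 r) (at t)))"
    by (simp only: contour_integral_integral integral_mult_right)
  also have "\<dots> = integral {0..1} (\<lambda>t. f (z + circlepath 0 r t *s v) / circlepath 0 r t)"
    by (intro integral_cong)
       (use circlepath_around_0(1)[OF r] in \<open>simp add: vd g_def power2_eq_square field_simps\<close>)
  finally show ?thesis by simp
qed

lemma discs_in_open:
  fixes z0 :: "complex ^ 'm::finite"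
  assumes "open S" "z0 \<in> S"
  obtains e r where "e > 0" "r > 0"
    "\<And>z \<zeta>. z \<in> ball z0 e \<Longrightarrow> norm \<zeta> \<le> r \<Longrightarrow> z + \<zeta> *s v \<in> S"
proof -
  obtain d where d: "d > 0" "ball z0 d \<subseteq> S" using assms open_contains_ball by blast
  define r where "r = d / (2 * (norm v + 1))"
  have nv: "norm v + 1 > 0" by (simp add: add_nonneg_pos)
  have r: "r > 0" using d nv by (simp add: r_def)
  have "z + \<zeta> *s v \<in> S" if "z \<in> ball z0 (d/2)" "norm \<zeta> \<le> r" for z \<zeta>
  proof -
    have "norm (\<zeta> *s v) \<le> r * norm v" using that by (simp add: norm_vector_smult mult_right_mono)
    also have "\<dots> \<le> d / 2" using d nv by (simp add: r_def field_simps)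
    finally have "dist z0 (z + \<zeta> *s v) < d"
      using that dist_triangle[of z0 "z + \<zeta> *s v" z] by (simp add: dist_norm)
    then show ?thesis using d by auto
  qed
  then show thesis using that[of "d/2" r] d r by auto
qed

lemma holomorphic_fun_on_continuous_on: "holomorphic_fun_on S f \<Longrightarrow> continuous_on S f"
  by (auto simp: holomorphic_fun_on_def intro!: continuous_at_imp_continuous_on differentiable_imp_continuous_within)

lemma continuous_on_circlepath: "continuous_on S (circlepath 0 r)"
  unfolding circlepath by (intro continuous_intros)

lemma continuous_on_shifted_circle:
  fixes g :: "complex ^ 'm::finite \<Rightarrow> complex"
  assumes "continuous_on S g" "r > 0" "\<And>z \<zeta>. z \<in> U \<Longrightarrow> norm \<zeta> \<le> r \<Longrightarrow> z + \<zeta> *s v \<in> S"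
  shows "continuous_on (U \<times> T) (\<lambda>(z, t). g (z + circlepath 0 r t *s v) / circlepath 0 r t)"
  unfolding split_beta
  by (intro continuous_intros continuous_on_compose2[OF assms(1)]
      continuous_on_compose2[OF continuous_on_circlepath[of UNIV]]
      bounded_linear.continuous_on[OF bounded_linear_vector_smult])
     (use assms in \<open>auto simp: circlepath_around_0\<close>)

lemma holomorphic_fun_on_D_continuous:
  fixes f :: "complex ^ 'm::finite \<Rightarrow> complex"
  assumes S: "open S" and f: "holomorphic_fun_on S f"
  shows "continuous_on S (\<lambda>z. D f z v)"
proof (rule continuous_at_imp_continuous_on, rule ballI)
  fix z0 assume z0: "z0 \<in> S"
  obtain e r where er: "e > 0" "r > 0"
    "\<And>z \<zeta>. z \<in> ball z0 e \<Longrightarrow> norm \<zeta> \<le> r \<Longrightarrow> z + \<zeta> *s v \<in> S"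
    using discs_in_open[OF S z0] by metis
  have "continuous_on (ball z0 e) (\<lambda>z. integral (cbox 0 1) (\<lambda>t::real. f (z + circlepath 0 r t *s v) / circlepath 0 r t))"
    by (rule integral_continuous_on_param,
        rule continuous_on_shifted_circle[OF holomorphic_fun_on_continuous_on[OF f] er(2,3)])
  then have "continuous_on (ball z0 e) (\<lambda>z. D f z v)"
    by (rule continuous_on_eq) (use D_cauchy_integral[OF f er(2,3)] in auto)
  then show "isCont (\<lambda>z. D f z v) z0"
    using er(1) by (simp add: continuous_on_eq_continuous_at)
qed

text \<open>
  In Cauchy's formula for \<open>D f z v\<close> the point \<open>z\<close> enters through \<open>f\<close> alone.  A first use of the formula, the
  preceding lemma, shows that \<open>D f z v\<close> is continuous in \<open>z\<close>; this licenses differentiation under the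
  integral, and the derivative of the integrand is complex linear since \<open>f\<close> is holomorphic.
\<close>

lemma holomorphic_fun_on_D:
  fixes f :: "complex ^ 'm::finite \<Rightarrow> complex"
  assumes S: "open S" and f: "holomorphic_fun_on S f"
  shows "holomorphic_fun_on S (\<lambda>z. D f z v)"
  unfolding holomorphic_fun_on_def
proof
  fix z0 assume z0: "z0 \<in> S"
  obtain e r where er: "e > 0" "r > 0"
    "\<And>z \<zeta>. z \<in> ball z0 e \<Longrightarrow> norm \<zeta> \<le> r \<Longrightarrow> z + \<zeta> *s v \<in> S"
    using discs_in_open[OF S z0] by metis
  define c where "c = circlepath 0 r"
  have c: "c t \<noteq> 0" "norm (c t) = r" for t using circlepath_around_0 er by (auto simp: c_def)
  define F where "F = (\<lambda>z t. f (z + c t *s v) / c t)"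
  define K where "K = (\<lambda>z t u. D f (z + c t *s v) u / c t)"
  have fd: "f differentiable (at w)" "D f w (J u) = \<i> * D f w u" if "w \<in> S" for w u
    using f that by (auto simp: holomorphic_fun_on_def)
  have inS: "z + c t *s v \<in> S" if "z \<in> ball z0 e" for z t
    using er(3)[OF that] c by simp
  have K: "(F' has_derivative K z t) (at z)"
    if "z \<in> ball z0 e" "F' = (\<lambda>z. F z t)" for z t F'
  proof -
    have shift: "((\<lambda>z. z + c t *s v) has_derivative (\<lambda>h. h)) (at z)"
      using has_derivative_add[OF has_derivative_ident has_derivative_const] by simp
    have "((\<lambda>z. f (z + c t *s v)) has_derivative D f (z + c t *s v)) (at z)"
      using has_derivative_compose[OF shift D_has_derivative[OF fd(1)[OF inS[OF that(1), of t]]]] .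
    from bounded_linear.has_derivative[OF bounded_linear_divide[of "c t"] this]
    show ?thesis by (simp add: K_def F_def that)
  qed
  have bl: "bounded_linear (K z t)" if "z \<in> ball z0 e" for z t
    using K[OF that refl] has_derivative_bounded_linear by blast
  have contD: "continuous_on (ball z0 e \<times> cbox 0 1) (\<lambda>(z,t). K z t u)" for u
    unfolding K_def c_def
    by (rule continuous_on_shifted_circle[OF holomorphic_fun_on_D_continuous[OF S f] er(2,3)])
  have contF: "continuous_on (ball z0 e \<times> cbox 0 (1::real)) (\<lambda>(z,t). F z t)"
    unfolding F_def c_def
    by (rule continuous_on_shifted_circle[OF holomorphic_fun_on_continuous_on[OF f] er(2,3)])
  \<comment> \<open>Differentiation under the integral sign asks for derivatives that are continuous as bounded linear
     maps; in finite dimension this can be tested on basis vectors.\<close>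
  define B where "B = (\<lambda>z t. Blinfun (K z t))"
  have B: "blinfun_apply (B z t) = K z t" if "z \<in> ball z0 e" for z t
    by (simp add: B_def bounded_linear_Blinfun_apply[OF bl[OF that]])
  have contB: "continuous_on (ball z0 e \<times> cbox 0 (1::real)) (\<lambda>(z,t). B z t)"
    by (rule continuous_on_blinfun_componentwise, rule continuous_on_eq[OF contD]) (auto simp: B)
  have z0e: "z0 \<in> ball z0 e" using er by simp
  have sub: "Pair z ` cbox 0 (1::real) \<subseteq> ball z0 e \<times> cbox 0 1" if "z \<in> ball z0 e" for z
    using that by auto
  have contBz: "continuous_on (cbox 0 (1::real)) (B z0)"
    using continuous_on_compose2[OF contB _ sub[OF z0e]] by (simp add: continuous_on_Pair)
  have contFz: "continuous_on (cbox 0 (1::real)) (F z)" if "z \<in> ball z0 e" for z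
    using continuous_on_compose2[OF contF _ sub[OF that]] by (simp add: continuous_on_Pair)
  have "((\<lambda>z. integral (cbox 0 1) (F z)) has_derivative integral (cbox 0 (1::real)) (B z0)) (at z0 within ball z0 e)"
  proof (rule leibniz_rule[OF _ _ contB z0e])
    show "((\<lambda>x. F x t) has_derivative B x t) (at x within ball z0 e)" if "x \<in> ball z0 e" for x t
      using K[OF that refl] by (auto simp: B[OF that] intro: has_derivative_at_withinI)
    show "F x integrable_on cbox 0 1" if "x \<in> ball z0 e" for x
      by (rule integrable_continuous[OF contFz[OF that]])
  qed simp
  then have "((\<lambda>z. integral (cbox 0 1) (F z)) has_derivative integral (cbox 0 (1::real)) (B z0)) (at z0)"
    using er(1) by (simp add: at_within_open[OF z0e])
  then have der: "((\<lambda>z. D f z v) has_derivative integral (cbox 0 (1::real)) (B z0)) (at z0)"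
    by (rule has_derivative_transform_within_open[OF _ open_ball z0e])
       (use D_cauchy_integral[OF f er(2,3)] in \<open>auto simp: F_def c_def\<close>)
  have app: "integral (cbox 0 1) (B z0) u = integral (cbox 0 (1::real)) (\<lambda>t. K z0 t u)" for u
    using integral_linear[OF integrable_continuous[OF contBz] bounded_linear_apply_blinfun[of u]]
      by (simp add: o_def B[OF z0e])
  have "integral (cbox 0 1) (B z0) (J u) = \<i> * integral (cbox 0 (1::real)) (B z0) u" for u
    unfolding app integral_mult_right[symmetric]
    by (simp add: K_def fd(2) inS[OF z0e])
  then show "(\<lambda>z. D f z v) differentiable (at z0) \<and> (\<forall>u. D (\<lambda>z. D f z v) z0 (J u) = \<i> * D (\<lambda>z. D f z v) z0 u)"
    using der D_eqI[OF der] by (auto simp: differentiable_def)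
qed

section \<open>The operators \<open>\<partial>\<close> and \<open>\<partial>\<close>-bar without coordinates\<close>

lemma D_coordinates:
  fixes f :: "complex ^ 'm::finite \<Rightarrow> complex"
  assumes "f differentiable (at z)"
  shows "D f z v = (\<Sum>j\<in>UNIV. of_real (Re (v $ j)) * D f z (axis j 1) + of_real (Im (v $ j)) * D f z (axis j \<i>))"
proof -
  have lin: "linear (D f z)" by (rule D_linear[OF assms])
  have "v = (\<Sum>j\<in>UNIV. Re (v $ j) *\<^sub>R axis j 1 + Im (v $ j) *\<^sub>R axis j \<i>)"
    by (auto simp: vec_eq_iff axis_def complex_eq_iff if_distrib cong: if_cong)
  then have "D f z v = D f z (\<Sum>j\<in>UNIV. Re (v $ j) *\<^sub>R axis j 1 + Im (v $ j) *\<^sub>R axis j \<i>)" by simp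
  also have "\<dots> = (\<Sum>j\<in>UNIV. Re (v $ j) *\<^sub>R D f z (axis j 1) + Im (v $ j) *\<^sub>R D f z (axis j \<i>))"
    by (simp add: linear_sum[OF lin] linear_add[OF lin] linear_scale[OF lin])
  finally show ?thesis by (simp only: scaleR_conv_of_real)
qed

text \<open>
  \<open>\<partial>f\<close> is the complex linear part of the differential.  In this form its behaviour under holomorphic changes
  of coordinates is visible.
\<close>

lemma del_eq:
  fixes f :: "complex ^ 'm::finite \<Rightarrow> complex"
  assumes "f differentiable (at z)"
  shows "del f z v = (D f z v - \<i> * D f z (J v)) / 2"
proof -
  have "2 * del f z v = (\<Sum>j\<in>UNIV. (D f z (axis j 1) - \<i> * D f z (axis j \<i>)) * v $ j)"
    by (simp add: del_def wirtinger_def sum_distrib_left)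
  also have "\<dots> = D f z v - \<i> * D f z (J v)"
    unfolding D_coordinates[OF assms, of v] D_coordinates[OF assms, of "J v"] sum_distrib_left
      sum_subtractf[symmetric]
  proof (rule sum.cong[OF refl])
    fix j
    have v: "v $ j = of_real (Re (v $ j)) + \<i> * of_real (Im (v $ j))" by (simp add: complex_eq)
    show "(D f z (axis j 1) - \<i> * D f z (axis j \<i>)) * v $ j =
      of_real (Re (v $ j)) * D f z (axis j 1) + of_real (Im (v $ j)) * D f z (axis j \<i>) -
        \<i> * (of_real (Re (J v $ j)) * D f z (axis j 1) + of_real (Im (J v $ j)) * D f z (axis j \<i>))"
      by (subst v) (simp add: J_def algebra_simps)
  qed
  finally show ?thesis by (simp add: eq_divide_eq mult.commute[of 2])
qed

text \<open>
  The counterpart for the complex antilinear part.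
\<close>

lemma delbar_eq:
  fixes f :: "complex ^ 'm::finite \<Rightarrow> complex"
  assumes "f differentiable (at z)"
  shows "(\<Sum>l\<in>UNIV. wirtinger_bar l f z * cnj (v $ l)) = (D f z v + \<i> * D f z (J v)) / 2"
proof -
  have "2 * (\<Sum>l\<in>UNIV. wirtinger_bar l f z * cnj (v $ l))
      = (\<Sum>j\<in>UNIV. (D f z (axis j 1) + \<i> * D f z (axis j \<i>)) * cnj (v $ j))"
    by (simp add: wirtinger_bar_def sum_distrib_left)
  also have "\<dots> = D f z v + \<i> * D f z (J v)"
    unfolding D_coordinates[OF assms, of v] D_coordinates[OF assms, of "J v"] sum_distrib_left
      sum.distrib[symmetric]
  proof (rule sum.cong[OF refl])
    fix j
    have v: "cnj (v $ j) = of_real (Re (v $ j)) - \<i> * of_real (Im (v $ j))" by (simp add: complex_eq_iff)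
    show "(D f z (axis j 1) + \<i> * D f z (axis j \<i>)) * cnj (v $ j) =
      of_real (Re (v $ j)) * D f z (axis j 1) + of_real (Im (v $ j)) * D f z (axis j \<i>) +
        \<i> * (of_real (Re (J v $ j)) * D f z (axis j 1) + of_real (Im (J v $ j)) * D f z (axis j \<i>))"
      by (subst v) (simp add: J_def algebra_simps)
  qed
  finally show ?thesis by (simp add: eq_divide_eq mult.commute[of 2])
qed

lemma wirtinger_sum:
  assumes "\<And>l. l \<in> I \<Longrightarrow> g l differentiable (at z)"
  shows "wirtinger j (\<lambda>w. \<Sum>l\<in>I. g l w * a l) z = (\<Sum>l\<in>I. wirtinger j (g l) z * a l)"
proof -
  have "((\<lambda>w. \<Sum>l\<in>I. g l w * a l) has_derivative (\<lambda>v. \<Sum>l\<in>I. D (g l) z v * a l)) (at z)"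
    by (intro has_derivative_sum has_derivative_mult_left D_has_derivative assms)
  from D_eqI[OF this] show ?thesis
    by (simp add: wirtinger_def sum_subtractf sum_divide_distrib sum_distrib_left algebra_simps diff_divide_distrib)
qed

text \<open>
  \<open>\<partial>\<partial>\<close>-bar \<open>f\<close> in terms of the real second derivative: both orders of its arguments are expanded by
  \<open>del_eq\<close> and \<open>delbar_eq\<close>, and by the symmetry of second derivatives only the mixed terms survive the
  antisymmetrization.
\<close>

lemma del_delbar_eq:
  fixes f :: "complex ^ 'm::finite \<Rightarrow> complex"
  assumes S: "open S" "z \<in> S" and f: "\<And>w. w \<in> S \<Longrightarrow> f differentiable (at w)"
    and f2: "\<And>v. (\<lambda>w. D f w v) differentiable (at z)"
  shows "del_delbar f z u v = \<i> / 2 * (D (\<lambda>w. D f w u) z (J v) - D (\<lambda>w. D f w (J u)) z v)"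
proof -
  define H where "H = (\<lambda>a b. D (\<lambda>w. D f w a) z b)"
  have sym: "H a b = H b a" for a b
    unfolding H_def by (rule symmetric_second_derivative[OF S f f2 f2])
  have wb: "wirtinger_bar l f differentiable (at z)" for l
    unfolding wirtinger_bar_def using f2 by (intro derivative_intros) auto
  have half: "(\<Sum>j\<in>UNIV. \<Sum>l\<in>UNIV. wirtinger j (wirtinger_bar l f) z * (a $ j * cnj (b $ l))) =
    (H b a + \<i> * H (J b) a - \<i> * (H b (J a) + \<i> * H (J b) (J a))) / 4" for a b
  proof -
    let ?g = "\<lambda>w. \<Sum>l\<in>UNIV. wirtinger_bar l f w * cnj (b $ l)"
    let ?h = "\<lambda>w. (D f w b + \<i> * D f w (J b)) / 2"
    have "(\<Sum>j\<in>UNIV. \<Sum>l\<in>UNIV. wirtinger j (wirtinger_bar l f) z * (a $ j * cnj (b $ l))) = del ?g z a"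
      unfolding del_def wirtinger_sum[OF wb] sum_distrib_right by (simp add: mult_ac)
    also have "\<dots> = (D ?g z a - \<i> * D ?g z (J a)) / 2"
      using wb by (intro del_eq derivative_intros) auto
    also have "D ?g z = D ?h z"
      by (rule D_cong_open(1)[OF S]) (simp add: delbar_eq[OF f])
    also have "D ?h z = (\<lambda>a. (H b a + \<i> * H (J b) a) / 2)"
      by (rule D_eqI) (auto intro!: derivative_eq_intros D_has_derivative f2 simp: H_def)
    finally show ?thesis by (simp add: add_divide_distrib diff_divide_distrib algebra_simps)
  qed
  have "del_delbar f z u v =
      (\<Sum>j\<in>UNIV. \<Sum>l\<in>UNIV. wirtinger j (wirtinger_bar l f) z * (u $ j * cnj (v $ l))) -
      (\<Sum>j\<in>UNIV. \<Sum>l\<in>UNIV. wirtinger j (wirtinger_bar l f) z * (v $ j * cnj (u $ l)))"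
    by (simp add: del_delbar_def sum_subtractf right_diff_distrib)
  also have "\<dots> = \<i> / 2 * (H u (J v) - H (J u) v)"
    unfolding half sym[of v] sym[of "J v"] by (simp add: field_simps)
  finally show ?thesis by (simp add: H_def)
qed

section \<open>The moment map and the connection form\<close>

text \<open>
  Let \<open>B\<close> be the second derivative of \<open>\<phi>\<close> at \<open>z\<close>.  If \<open>X\<close> is holomorphic, the (0,1)-part of the differential of
  \<open>\<partial>\<phi>(X)\<close> only sees the derivative of \<open>\<partial>\<phi>\<close>, since \<open>\<partial>\<phi>\<close> and \<open>D X\<close> are complex linear.  That derivative is
  \<open>v \<mapsto> (B(X, v) - \<i> B(J X, v))/2\<close>, whereas the hypothesis on \<open>h\<close> reads
  \<open>dh(v) = (B(X, J v) - B(J X, v))/2\<close>; the (0,1)-parts of \<open>dh\<close> and of \<open>\<i>\<close> times the former add up to \<open>0\<close>.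
\<close>

lemma moment_map_holomorphic:
  fixes \<phi> :: "complex ^ 'm::finite \<Rightarrow> complex" and h :: "complex ^ 'm \<Rightarrow> real"
  assumes S: "open S" "z \<in> S" and f: "\<And>w. w \<in> S \<Longrightarrow> \<phi> differentiable (at w)"
    and f2: "\<And>v. (\<lambda>w. D \<phi> w v) differentiable (at z)"
    and X: "X differentiable (at z)" "\<And>v. D X z (J v) = J (D X z v)"
    and h: "h differentiable (at z)"
    and ham: "\<And>Y. complex_of_real (D h z Y) = - \<i> * del_delbar \<phi> z (X z) Y"
  defines "P \<equiv> \<lambda>w. complex_of_real (h w) + \<i> * del \<phi> w (X w)"
  shows "P differentiable (at z)" "D P z (J v) = \<i> * D P z v"
proof -
  define H where "H = (\<lambda>a b. D (\<lambda>w. D \<phi> w a) z b)"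
  have linH: "linear (H a)" for a unfolding H_def by (rule D_linear[OF f2])
  have linp: "linear (D \<phi> z)" by (rule D_linear[OF f[OF S(2)]])
  have JX: "(\<lambda>w. J (X w)) differentiable (at z)" "D (\<lambda>w. J (X w)) z v = J (D X z v)" for v
    using D_bounded_linear_compose[OF bounded_linear_J X(1)] by auto
  have along: "((\<lambda>w. D \<phi> w (X w)) has_derivative (\<lambda>v. H (X z) v + D \<phi> z (D X z v))) (at z)"
     "((\<lambda>w. D \<phi> w (J (X w))) has_derivative (\<lambda>v. H (J (X z)) v + D \<phi> z (J (D X z v)))) (at z)"
    using has_derivative_D_along[OF S f f2 X(1)] has_derivative_D_along[OF S f f2 JX(1)] JX(2)
    by (auto simp: H_def)
  let ?P = "\<lambda>w. complex_of_real (h w) + \<i> * ((D \<phi> w (X w) - \<i> * D \<phi> w (J (X w))) / 2)"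
  let ?P' = "\<lambda>v. complex_of_real (D h z v) + \<i> * ((H (X z) v + D \<phi> z (D X z v)
      - \<i> * (H (J (X z)) v + D \<phi> z (J (D X z v)))) / 2)"
  have "(?P has_derivative ?P') (at z)"
    using along by (auto intro!: derivative_eq_intros D_has_derivative h
        bounded_linear.has_derivative[OF bounded_linear_of_real])
  then have der: "(P has_derivative ?P') (at z)"
    by (rule has_derivative_transform_within_open[OF _ S]) (simp add: P_def del_eq[OF f])
  then show "P differentiable (at z)" by (auto simp: differentiable_def)
  have dh: "complex_of_real (D h z v) = (H (X z) (J v) - H (J (X z)) v) / 2" for v
    by (simp add: ham del_delbar_eq[OF S f f2] H_def)
  show "D P z (J v) = \<i> * D P z v"
    unfolding D_eqI[OF der] dh
    by (simp add: X(2) J_J linear_neg[OF linH] linear_neg[OF linp] field_simps)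
qed

lemma has_derivative_complex_ln:
  fixes q :: "'a::real_normed_vector \<Rightarrow> real"
  assumes "(q has_derivative q') (at z)" "q z > 0"
  shows "((\<lambda>w. complex_of_real (ln (q w))) has_derivative (\<lambda>v. complex_of_real (q' v / q z))) (at z)"
  using assms by (auto intro!: derivative_eq_intros bounded_linear.has_derivative[OF bounded_linear_of_real]
      simp: field_simps)

text \<open>
  Locally \<open>log |g|\<^sup>2 = log g + log\<close> of the conjugate of \<open>g\<close>, and \<open>\<partial>\<close> kills the second summand.
\<close>

lemma del_ln_cmod_square:
  fixes g :: "complex ^ 'm::finite \<Rightarrow> complex"
  assumes g: "g differentiable (at z)" "\<And>v. D g z (J v) = \<i> * D g z v" and nz: "g z \<noteq> 0"
  shows "(\<lambda>w. complex_of_real (ln ((cmod (g w))\<^sup>2))) differentiable (at z)"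
    "del (\<lambda>w. complex_of_real (ln ((cmod (g w))\<^sup>2))) z v = D g z v / g z"
proof -
  have pos: "(cmod (g z))\<^sup>2 > 0" using nz by simp
  have "((\<lambda>w. g w \<bullet> g w) has_derivative (\<lambda>v. g z \<bullet> D g z v + D g z v \<bullet> g z)) (at z)"
    by (intro has_derivative_inner D_has_derivative[OF g(1)])
  then have sq: "((\<lambda>w. (cmod (g w))\<^sup>2) has_derivative (\<lambda>v. g z \<bullet> D g z v + D g z v \<bullet> g z)) (at z)"
    by (simp add: power2_norm_eq_inner)
  have der: "((\<lambda>w. complex_of_real (ln ((cmod (g w))\<^sup>2))) has_derivative
      (\<lambda>v. complex_of_real (2 * (g z \<bullet> D g z v) / (cmod (g z))\<^sup>2))) (at z)"
    using has_derivative_complex_ln[OF sq pos] by (simp add: inner_commute)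
  then show diff: "(\<lambda>w. complex_of_real (ln ((cmod (g w))\<^sup>2))) differentiable (at z)"
    by (auto simp: differentiable_def)
  \<comment> \<open>With a = g z and b = D g z v the left-hand side is twice the value of the (1,0)-part.\<close>
  have "complex_of_real (2 * (a \<bullet> b) / (cmod a)\<^sup>2) - \<i> * complex_of_real (2 * (a \<bullet> (\<i> * b)) / (cmod a)\<^sup>2)
     = 2 * (b / a)" if "a \<noteq> 0" for a b :: complex
  proof -
    have "b / a = b * cnj a / (cmod a)\<^sup>2" by (rule complex_div_cnj)
    also have "b * cnj a = complex_of_real (a \<bullet> b) - \<i> * complex_of_real (a \<bullet> (\<i> * b))"
      by (simp add: complex_eq_iff inner_complex_def algebra_simps)
    finally have e: "b / a = (complex_of_real (a \<bullet> b) - \<i> * complex_of_real (a \<bullet> (\<i> * b))) / complex_of_real ((cmod a)\<^sup>2)"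
      by simp
    show ?thesis unfolding e by (simp add: diff_divide_distrib)
  qed
  from this[OF nz, of "D g z v"] show "del (\<lambda>w. complex_of_real (ln ((cmod (g w))\<^sup>2))) z v = D g z v / g z"
    by (simp only: del_eq[OF diff] D_eqI[OF der] g(2)) simp
qed

lemma smooth_on_differentiable: "smooth_on S f \<Longrightarrow> z \<in> S \<Longrightarrow> f differentiable (at z)"
  unfolding smooth_on_def using C_k_on.simps(2) by blast

lemma smooth_on_D: "smooth_on S f \<Longrightarrow> smooth_on S (\<lambda>z. D f z v)"
  unfolding smooth_on_def using C_k_on.simps(2) by blast

lemma ln_smooth_twice_differentiable:
  fixes g :: "'a::real_normed_vector \<Rightarrow> real"
  assumes S: "open S" "z \<in> S" and g: "smooth_on S g" and pos: "\<And>w. w \<in> S \<Longrightarrow> g w > 0"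
  shows "(\<lambda>w. complex_of_real (ln (g w))) differentiable (at z)"
    "(\<lambda>w. D (\<lambda>w. complex_of_real (ln (g w))) w v) differentiable (at z)"
proof -
  have der: "((\<lambda>w. complex_of_real (ln (g w))) has_derivative (\<lambda>v. complex_of_real (D g w v / g w))) (at w)"
    if "w \<in> S" for w
    by (rule has_derivative_complex_ln[OF D_has_derivative[OF smooth_on_differentiable[OF g that]] pos[OF that]])
  then show "(\<lambda>w. complex_of_real (ln (g w))) differentiable (at z)" using S by (auto simp: differentiable_def)
  have "(\<lambda>w. D g w v / g w) differentiable (at z)"
    using smooth_on_differentiable[OF smooth_on_D[OF g] S(2)] smooth_on_differentiable[OF g S(2)] pos[OF S(2)]
    by (intro derivative_intros) auto
  then have "(\<lambda>w. complex_of_real (D g w v / g w)) differentiable (at z)"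
    by (rule D_bounded_linear_compose(1)[OF bounded_linear_of_real])
  then show "(\<lambda>w. D (\<lambda>w. complex_of_real (ln (g w))) w v) differentiable (at z)"
    using D_cong_open(2)[OF S, of "\<lambda>w. D (\<lambda>w. complex_of_real (ln (g w))) w v"] D_eqI[OF der] by simp
qed

lemma holomorphic_fun_on_D_along:
  fixes f :: "complex ^ 'm::finite \<Rightarrow> complex"
  assumes S: "open S" and f: "holomorphic_fun_on S f" and X: "holomorphic_map_on S X"
  shows "holomorphic_fun_on S (\<lambda>w. D f w (X w))"
  unfolding holomorphic_fun_on_def
proof
  fix z assume z: "z \<in> S"
  have fd: "\<And>w. w \<in> S \<Longrightarrow> f differentiable (at w)" "\<And>v. D f z (J v) = \<i> * D f z v"
    using f z by (auto simp: holomorphic_fun_on_def)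
  have f2: "(\<lambda>w. D f w v) differentiable (at z)" "D (\<lambda>w. D f w v) z (J u) = \<i> * D (\<lambda>w. D f w v) z u" for u v
    using holomorphic_fun_on_D[OF S f] z by (auto simp: holomorphic_fun_on_def)
  have Xd: "X differentiable (at z)" "\<And>v. D X z (J v) = J (D X z v)"
    using X z by (auto simp: holomorphic_map_on_def)
  have der: "((\<lambda>w. D f w (X w)) has_derivative (\<lambda>v. D (\<lambda>w. D f w (X z)) z v + D f z (D X z v))) (at z)"
    by (rule has_derivative_D_along[OF S z fd(1) f2(1) Xd(1)])
  then show "(\<lambda>w. D f w (X w)) differentiable at z \<and> (\<forall>v. D (\<lambda>w. D f w (X w)) z (J v) = \<i> * D (\<lambda>w. D f w (X w)) z v)"
    by (auto simp: D_eqI[OF der] Xd f2 fd distrib_left intro: differentiableI)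
qed

lemma holomorphic_fun_on_add:
  assumes "holomorphic_fun_on S f" "holomorphic_fun_on S g"
  shows "holomorphic_fun_on S (\<lambda>w. f w + g w)"
  unfolding holomorphic_fun_on_def
proof
  fix z assume "z \<in> S"
  then have *: "f differentiable (at z)" "\<And>v. D f z (J v) = \<i> * D f z v" "g differentiable (at z)" "\<And>v. D g z (J v) = \<i> * D g z v"
    using assms by (auto simp: holomorphic_fun_on_def)
  have der: "((\<lambda>w. f w + g w) has_derivative (\<lambda>v. D f z v + D g z v)) (at z)"
    by (intro has_derivative_add D_has_derivative *)
  show "(\<lambda>w. f w + g w) differentiable at z \<and> (\<forall>v. D (\<lambda>w. f w + g w) z (J v) = \<i> * D (\<lambda>w. f w + g w) z v)"
    using der by (auto simp: D_eqI[OF der] * distrib_left intro: differentiableI)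
qed

lemma holomorphic_fun_on_mult:
  assumes "holomorphic_fun_on S f" "holomorphic_fun_on S g"
  shows "holomorphic_fun_on S (\<lambda>w. f w * g w)"
  unfolding holomorphic_fun_on_def
proof
  fix z assume "z \<in> S"
  then have *: "f differentiable (at z)" "\<And>v. D f z (J v) = \<i> * D f z v" "g differentiable (at z)" "\<And>v. D g z (J v) = \<i> * D g z v"
    using assms by (auto simp: holomorphic_fun_on_def)
  have der: "((\<lambda>w. f w * g w) has_derivative (\<lambda>v. f z * D g z v + D f z v * g z)) (at z)"
    by (intro has_derivative_mult D_has_derivative *)
  show "(\<lambda>w. f w * g w) differentiable at z \<and> (\<forall>v. D (\<lambda>w. f w * g w) z (J v) = \<i> * D (\<lambda>w. f w * g w) z v)"
    using der by (auto simp: D_eqI[OF der] * algebra_simps intro: differentiableI)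
qed

lemma holomorphic_fun_on_const: "holomorphic_fun_on S (\<lambda>w. a)"
  by (simp add: holomorphic_fun_on_def)

section \<open>Charts\<close>

lemma chart_facts:
  assumes "compact_complex_manifold A" "c \<in> A"
  shows "open (dom_ch c)" "open (coord c ` dom_ch c)"
    "x \<in> dom_ch c \<Longrightarrow> param c (coord c x) = x"
    "w \<in> coord c ` dom_ch c \<Longrightarrow> coord c (param c w) = w"
    "w \<in> coord c ` dom_ch c \<Longrightarrow> param c w \<in> dom_ch c"
    "continuous_on (dom_ch c) (coord c)" "continuous_on (coord c ` dom_ch c) (param c)"
proof -
  have h: "homeomorphism (dom_ch c) (coord c ` dom_ch c) (coord c) (param c)"
    and "open (dom_ch c)" "open (coord c ` dom_ch c)"
    using assms by (auto simp: compact_complex_manifold_def)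
  then show "open (dom_ch c)" "open (coord c ` dom_ch c)" by auto
  show "x \<in> dom_ch c \<Longrightarrow> param c (coord c x) = x" "w \<in> coord c ` dom_ch c \<Longrightarrow> coord c (param c w) = w"
    "w \<in> coord c ` dom_ch c \<Longrightarrow> param c w \<in> dom_ch c"
    "continuous_on (dom_ch c) (coord c)" "continuous_on (coord c ` dom_ch c) (param c)"
    using h unfolding homeomorphism_def by auto
qed

lemma chart_at:
  assumes "compact_complex_manifold A"
  shows "chart_at A x \<in> A" "x \<in> dom_ch (chart_at A x)"
proof -
  have "\<exists>c. c \<in> A \<and> x \<in> dom_ch c" using assms unfolding compact_complex_manifold_def by blast
  from someI_ex[OF this] show "chart_at A x \<in> A" "x \<in> dom_ch (chart_at A x)"
    by (auto simp: chart_at_def)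
qed

lemma open_coord_image:
  assumes "compact_complex_manifold A" "c \<in> A" "open V"
  shows "open (coord c ` (dom_ch c \<inter> V))"
proof -
  have h: "homeomorphism (dom_ch c) (coord c ` dom_ch c) (coord c) (param c)"
    using assms by (auto simp: compact_complex_manifold_def)
  have "openin (top_of_set (coord c ` dom_ch c)) (coord c ` (dom_ch c \<inter> V))"
    by (rule homeomorphism_imp_open_map[OF h]) (use assms in \<open>auto simp: openin_open\<close>)
  then show ?thesis using chart_facts(2)[OF assms(1,2)] openin_open_eq by blast
qed

lemma coord_imageD:
  assumes "compact_complex_manifold A" "c \<in> A" "w \<in> coord c ` (dom_ch c \<inter> V)"
  shows "w \<in> coord c ` dom_ch c" "param c w \<in> dom_ch c" "param c w \<in> V" "coord c (param c w) = w"
  using assms(3) chart_facts(3)[OF assms(1,2)] by auto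

lemma transition_holomorphic:
  assumes "compact_complex_manifold A" "c \<in> A" "c' \<in> A" "x \<in> dom_ch c" "x \<in> dom_ch c'"
  shows "(coord c' \<circ> param c) differentiable (at (coord c x))"
    "D (coord c' \<circ> param c) (coord c x) (J v) = J (D (coord c' \<circ> param c) (coord c x) v)"
  using assms unfolding compact_complex_manifold_def holomorphic_map_on_def by blast+

lemma function_chart_change:
  assumes A: "compact_complex_manifold A" "c \<in> A" "c' \<in> A"
  assumes "w \<in> coord c ` (dom_ch c \<inter> dom_ch c')"
  shows "(g \<circ> param c) w = (g \<circ> param c') ((coord c' \<circ> param c) w)"
  using coord_imageD[OF A(1,2) assms(4)] chart_facts(3)[OF A(1,3)] by simp

text \<open>
  The chain rule for \<open>g \<circ> param c = (g \<circ> param c') \<circ> (coord c' \<circ> param c)\<close>, valid near the point.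
\<close>

lemma D_chart_change:
  assumes A: "compact_complex_manifold A" "c \<in> A" "c' \<in> A" "x \<in> dom_ch c" "x \<in> dom_ch c'"
    and g: "(g \<circ> param c') differentiable (at (coord c' x))"
  shows "D (g \<circ> param c) (coord c x) v = D (g \<circ> param c') (coord c' x) (D (coord c' \<circ> param c) (coord c x) v)"
proof -
  let ?T = "coord c' \<circ> param c"
  have Tx: "?T (coord c x) = coord c' x" using chart_facts(3)[OF A(1,2,4)] by simp
  have "((\<lambda>w. (g \<circ> param c') (?T w)) has_derivative (\<lambda>v. D (g \<circ> param c') (coord c' x) (D ?T (coord c x) v))) (at (coord c x))"
    by (rule has_derivative_compose[OF D_has_derivative[OF transition_holomorphic(1)[OF A]]])
       (use g in \<open>simp only: Tx D_has_derivative\<close>)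
  then have "((g \<circ> param c) has_derivative (\<lambda>v. D (g \<circ> param c') (coord c' x) (D ?T (coord c x) v))) (at (coord c x))"
    by (rule has_derivative_transform_within_open[OF _ open_coord_image[OF A(1,2) chart_facts(1)[OF A(1,3)]]])
       (use A in \<open>blast intro: function_chart_change[OF A(1-3), symmetric]\<close>)+
  from D_eqI[OF this] show ?thesis by simp
qed

text \<open>
  \<open>\<partial>\<close> commutes with changes of charts because these have complex linear differentials.
\<close>

lemma del_chart_change:
  assumes A: "compact_complex_manifold A" "c \<in> A" "c' \<in> A" "x \<in> dom_ch c" "x \<in> dom_ch c'"
    and g: "(g \<circ> param c') differentiable (at (coord c' x))" "(g \<circ> param c) differentiable (at (coord c x))"
  shows "del (g \<circ> param c) (coord c x) v = del (g \<circ> param c') (coord c' x) (D (coord c' \<circ> param c) (coord c x) v)"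
  unfolding del_eq[OF g(1)] del_eq[OF g(2)] D_chart_change[OF A g(1)]
  by (simp add: transition_holomorphic(2)[OF A])

section \<open>Holomorphy of the generator of a holomorphic flow\<close>

text \<open>
  Let \<open>F(t, w)\<close> be the flow in the chart.  The field is \<open>\<partial>\<^sub>t F\<close> at time \<open>0\<close>, so that its derivative along \<open>v\<close>
  is \<open>\<partial>\<^sub>v\<partial>\<^sub>t F = \<partial>\<^sub>t\<partial>\<^sub>v F\<close>; and \<open>v \<mapsto> \<partial>\<^sub>v F(t, w)\<close> commutes with \<open>J\<close> for every \<open>t\<close> since the flow preserves
  the complex structure.
\<close>

lemma holomorphic_generator:
  fixes A :: "('p::t2_space, 'm::finite) chart set"
  assumes A: "compact_complex_manifold A" "c \<in> A" and gen: "holomorphic_R_action_generator A \<xi>"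
  shows "holomorphic_map_on (coord c ` dom_ch c) (\<xi> c \<circ> param c)"
  unfolding holomorphic_map_on_def
proof
  obtain \<Phi> where fl: "flow_of A \<xi> \<Phi>" and pJ: "\<And>t. preserves_J A (\<Phi> t)"
    using gen by (auto simp: holomorphic_R_action_generator_def)
  let ?U = "coord c ` dom_ch c"
  define F where "F = (\<lambda>(t, w). coord c (\<Phi> t (param c w)))"
  define \<Omega> where "\<Omega> = {(t, w). w \<in> ?U \<and> \<Phi> t (param c w) \<in> dom_ch c}"
  have smF: "smooth_on \<Omega> F"
    using fl A(2) unfolding flow_of_def F_def \<Omega>_def by blast
  have contP: "continuous_on UNIV (\<lambda>(t, x). \<Phi> t x)" and \<Phi>0: "\<Phi> 0 = id"
    using fl by (auto simp: flow_of_def)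
  have "continuous_on (UNIV \<times> ?U) (\<lambda>p. (\<lambda>(t, x). \<Phi> t x) (fst p, param c (snd p)))"
    by (rule continuous_on_compose2[OF contP])
       (auto intro!: continuous_intros continuous_on_compose2[OF chart_facts(7)[OF A]])
  then have "open ((UNIV \<times> ?U) \<inter> (\<lambda>p. (\<lambda>(t, x). \<Phi> t x) (fst p, param c (snd p))) -` dom_ch c)"
    by (intro continuous_open_preimage open_Times open_UNIV chart_facts(1,2)[OF A])
  also have "(UNIV \<times> ?U) \<inter> (\<lambda>p. (\<lambda>(t, x). \<Phi> t x) (fst p, param c (snd p))) -` dom_ch c = \<Omega>"
    by (auto simp: \<Omega>_def)
  finally have op: "open \<Omega>" .
  have Fd: "F differentiable (at p)" if "p \<in> \<Omega>" for p by (rule smooth_on_differentiable[OF smF that])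
  have DFd: "(\<lambda>p. D F p v) differentiable (at p)" if "p \<in> \<Omega>" for p v
    by (rule smooth_on_differentiable[OF smooth_on_D[OF smF] that])
  have in\<Omega>: "(0, w) \<in> \<Omega>" if "w \<in> ?U" for w
    using that chart_facts(5)[OF A] by (simp add: \<Omega>_def \<Phi>0)
  have time: "D F (0, w) (1, 0) = (\<xi> c \<circ> param c) w" if w: "w \<in> ?U" for w
  proof -
    have 1: "((\<lambda>\<tau>. (\<tau>, w)) has_derivative (\<lambda>h. (h, 0))) (at 0)"
      by (auto intro!: derivative_eq_intros)
    have "((\<lambda>\<tau>. F (\<tau>, w)) has_derivative (\<lambda>h. D F (0, w) (h, 0))) (at 0)"
      by (rule has_derivative_compose[OF 1 D_has_derivative[OF Fd[OF in\<Omega>[OF w]]]])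
    moreover have "((\<lambda>\<tau>. F (\<tau>, w)) has_derivative (\<lambda>h. h *\<^sub>R \<xi> c (\<Phi> 0 (param c w)))) (at 0)"
    proof -
      have "\<Phi> 0 (param c w) \<in> dom_ch c" using chart_facts(5)[OF A w] by (simp add: \<Phi>0)
      then have "((\<lambda>\<tau>. coord c (\<Phi> \<tau> (param c w))) has_vector_derivative \<xi> c (\<Phi> 0 (param c w))) (at 0)"
        using fl A(2) unfolding flow_of_def by blast
      then show ?thesis by (simp add: has_vector_derivative_def F_def)
    qed
    ultimately have "(\<lambda>h. D F (0, w) (h, 0)) = (\<lambda>h. h *\<^sub>R \<xi> c (\<Phi> 0 (param c w)))"
      by (rule has_derivative_unique)
    from fun_cong[OF this, of 1] show ?thesis by (simp add: \<Phi>0)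
  qed
  have space: "D F p (0, J v) = J (D F p (0, v))" if p: "p \<in> \<Omega>" for p v
  proof -
    obtain t w where tw: "p = (t, w)" by force
    have w: "w \<in> ?U" "\<Phi> t (param c w) \<in> dom_ch c" using p by (auto simp: \<Omega>_def tw)
    have 1: "((\<lambda>w. (t, w)) has_derivative (\<lambda>v. (0, v))) (at w)"
      by (auto intro!: derivative_eq_intros)
    have "((\<lambda>w. F (t, w)) has_derivative (\<lambda>v. D F (t, w) (0, v))) (at w)"
      by (rule has_derivative_compose[OF 1 D_has_derivative[OF Fd[OF p[unfolded tw]]]])
    then have "D (coord c \<circ> \<Phi> t \<circ> param c) w = (\<lambda>v. D F (t, w) (0, v))"
      by (intro D_eqI) (simp add: F_def o_def)
    moreover have "D (coord c \<circ> \<Phi> t \<circ> param c) w (J v) = J (D (coord c \<circ> \<Phi> t \<circ> param c) w v)"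
      using pJ[of t] A(2) w chart_facts(4,5)[OF A w(1)] unfolding preserves_J_def by metis
    ultimately show ?thesis by (simp add: tw)
  qed
  fix w assume w: "w \<in> ?U"
  have 1: "((\<lambda>w. (0::real, w)) has_derivative (\<lambda>v. (0, v))) (at w)"
    by (auto intro!: derivative_eq_intros)
  have "((\<lambda>w. D F (0, w) (1, 0)) has_derivative (\<lambda>v. D (\<lambda>p. D F p (1, 0)) (0, w) (0, v))) (at w)"
    by (rule has_derivative_compose[OF 1 D_has_derivative[OF DFd[OF in\<Omega>[OF w]]]])
  then have der: "((\<xi> c \<circ> param c) has_derivative (\<lambda>v. D (\<lambda>p. D F p (1, 0)) (0, w) (0, v))) (at w)"
    by (rule has_derivative_transform_within_open[OF _ chart_facts(2)[OF A] w]) (rule time)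
  have sym: "D (\<lambda>p. D F p (1, 0)) (0, w) (0, v) = D (\<lambda>p. D F p (0, v)) (0, w) (1, 0)" for v
    by (rule symmetric_second_derivative[OF op in\<Omega>[OF w] Fd]) (use DFd[OF in\<Omega>[OF w]] in auto)
  have "D (\<lambda>p. D F p (0, J v)) (0, w) u = J (D (\<lambda>p. D F p (0, v)) (0, w) u)" for u v
    using D_cong_open(1)[OF op in\<Omega>[OF w], of "\<lambda>p. D F p (0, J v)" "\<lambda>p. J (D F p (0, v))"] space
      D_bounded_linear_compose(2)[OF bounded_linear_J DFd[OF in\<Omega>[OF w]]] by simp
  then show "(\<xi> c \<circ> param c) differentiable at w \<and>
      (\<forall>v. D (\<xi> c \<circ> param c) w (J v) = J (D (\<xi> c \<circ> param c) w v))"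
    using der by (auto simp: D_eqI[OF der] sym intro: differentiableI)
qed

section \<open>The Chern connection in charts and frames\<close>

lemma line_bundle_facts:
  assumes "hermitian_holomorphic_line_bundle A L" "i \<in> index L" "j \<in> index L"
  shows "open (triv L i)" "x \<in> triv L i \<Longrightarrow> weight L i x > 0"
    "x \<in> triv L i \<inter> triv L j \<Longrightarrow> trans_fun L i j x \<noteq> 0"
    "x \<in> triv L i \<inter> triv L j \<Longrightarrow> weight L j x = (cmod (trans_fun L i j x))\<^sup>2 * weight L i x"
    "c \<in> A \<Longrightarrow> smooth_on (coord c ` (dom_ch c \<inter> triv L i)) (weight L i \<circ> param c)"
    "c \<in> A \<Longrightarrow> holomorphic_fun_on (coord c ` (dom_ch c \<inter> triv L i \<inter> triv L j)) (trans_fun L i j \<circ> param c)"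
  using assms unfolding hermitian_holomorphic_line_bundle_def by meson+

lemma log_weight_twice_differentiable:
  fixes A :: "('p::t2_space, 'm::finite) chart set"
  assumes A: "compact_complex_manifold A" "c \<in> A" and L: "hermitian_holomorphic_line_bundle A L" "i \<in> index L"
    and w: "w \<in> coord c ` (dom_ch c \<inter> triv L i)"
  shows "(\<lambda>w. complex_of_real (ln (weight L i (param c w)))) differentiable (at w)"
    "(\<lambda>w. D (\<lambda>w. complex_of_real (ln (weight L i (param c w)))) w v) differentiable (at w)"
proof -
  have op: "open (coord c ` (dom_ch c \<inter> triv L i))"
    by (rule open_coord_image[OF A line_bundle_facts(1)[OF L L(2)]])
  have sm: "smooth_on (coord c ` (dom_ch c \<inter> triv L i)) (\<lambda>w. weight L i (param c w))"
    using line_bundle_facts(5)[OF L L(2) A(2)] by (simp add: o_def)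
  have pos: "weight L i (param c u) > 0" if "u \<in> coord c ` (dom_ch c \<inter> triv L i)" for u
    by (rule line_bundle_facts(2)[OF L L(2) coord_imageD(3)[OF A that]])
  show "(\<lambda>w. complex_of_real (ln (weight L i (param c w)))) differentiable (at w)"
    "(\<lambda>w. D (\<lambda>w. complex_of_real (ln (weight L i (param c w)))) w v) differentiable (at w)"
    using ln_smooth_twice_differentiable[OF op w sm pos] by auto
qed

lemma del_scale:
  assumes "g differentiable (at z)"
  shows "del (\<lambda>w. a * g w) z v = a * del g z v"
proof -
  have der: "((\<lambda>w. a * g w) has_derivative (\<lambda>v. a * D g z v)) (at z)"
    by (intro has_derivative_mult_right D_has_derivative assms)
  then have "(\<lambda>w. a * g w) differentiable (at z)" by (auto simp: differentiable_def)
  from del_eq[OF this] show ?thesis by (simp add: D_eqI[OF der] del_eq[OF assms] algebra_simps)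
qed

lemma del_add:
  fixes f g :: "complex ^ 'm::finite \<Rightarrow> complex"
  assumes "f differentiable (at z)" "g differentiable (at z)"
  shows "del (\<lambda>w. f w + g w) z v = del f z v + del g z v"
proof -
  have der: "((\<lambda>w. f w + g w) has_derivative (\<lambda>v. D f z v + D g z v)) (at z)"
    by (intro has_derivative_add D_has_derivative assms)
  then have "(\<lambda>w. f w + g w) differentiable (at z)" by (auto simp: differentiable_def)
  from del_eq[OF this] show ?thesis
    by (simp add: D_eqI[OF der] del_eq[OF assms(1)] del_eq[OF assms(2)] add_divide_distrib diff_divide_distrib
        distrib_left)
qed

lemma del_cong_open:
  assumes "open S" "z \<in> S" "\<And>w. w \<in> S \<Longrightarrow> f w = g w"
  shows "del f z = del g z"
  using D_cong_open(1)[OF assms] by (simp add: del_def wirtinger_def fun_eq_iff)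

text \<open>
  The Chern derivative uses an arbitrarily chosen chart at each point, which need not be the same at nearby
  points.  Holomorphy can only be examined in a fixed chart, hence this independence of the chart.
\<close>

lemma chern_derivative_in_chart:
  fixes A :: "('p::t2_space, 'm::finite) chart set"
  assumes A: "compact_complex_manifold A" "c \<in> A" and L: "hermitian_holomorphic_line_bundle A L" "i \<in> index L"
    and \<xi>: "smooth_vector_field A \<xi>" and s: "s \<in> holomorphic_sections A L k"
    and x: "x \<in> dom_ch c" "x \<in> triv L i"
  shows "chern_derivative A L k \<xi> s i x = D (s i \<circ> param c) (coord c x) (\<xi> c x)
     + s i x * (of_nat k * del (\<lambda>w. complex_of_real (ln (weight L i (param c w)))) (coord c x) (\<xi> c x))"
proof -
  define c' where "c' = chart_at A x"
  have c': "c' \<in> A" "x \<in> dom_ch c'" using chart_at[OF A(1)] by (auto simp: c'_def)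
  let ?g = "\<lambda>x. complex_of_real (ln (weight L i x))"
  have inV: "coord b x \<in> coord b ` (dom_ch b \<inter> triv L i)" if "x \<in> dom_ch b" for b :: "('p, 'm) chart"
    using that x by auto
  have gd: "(?g \<circ> param b) differentiable (at (coord b x))" if "b \<in> A" "x \<in> dom_ch b" for b
    using log_weight_twice_differentiable(1)[OF A(1) that(1) L inV[OF that(2)]] by (simp add: o_def)
  have sd: "(s i \<circ> param b) differentiable (at (coord b x))" if "b \<in> A" "x \<in> dom_ch b" for b
    using s that L inV[OF that(2)] unfolding holomorphic_sections_def holomorphic_fun_on_def by blast
  have \<xi>c: "\<xi> c' x = D (coord c' \<circ> param c) (coord c x) (\<xi> c x)"
    using \<xi> A(2) c' x unfolding smooth_vector_field_def by blast
  have op: "open (coord c' ` (dom_ch c' \<inter> triv L i))"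
    by (rule open_coord_image[OF A(1) c'(1) line_bundle_facts(1)[OF L L(2)]])
  have "chern_derivative A L k \<xi> s i x = D (s i \<circ> param c') (coord c' x) (\<xi> c' x)
             + s i x * del (\<lambda>w. complex_of_real (ln (weight L i (param c' w) ^ k))) (coord c' x) (\<xi> c' x)"
    using L x by (simp add: chern_derivative_def c'_def Let_def)
  also have "del (\<lambda>w. complex_of_real (ln (weight L i (param c' w) ^ k))) (coord c' x) =
      del (\<lambda>w. of_nat k * (?g \<circ> param c') w) (coord c' x)"
  proof (rule del_cong_open[OF op inV[OF c'(2)]])
    fix w assume w: "w \<in> coord c' ` (dom_ch c' \<inter> triv L i)"
    have "weight L i (param c' w) > 0"
      by (rule line_bundle_facts(2)[OF L L(2) coord_imageD(3)[OF A(1) c'(1) w]])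
    then show "complex_of_real (ln (weight L i (param c' w) ^ k)) = of_nat k * (?g \<circ> param c') w"
      by (simp add: ln_realpow)
  qed
  also have "\<dots> = (\<lambda>v. of_nat k * del (?g \<circ> param c') (coord c' x) v)"
    by (rule ext) (rule del_scale[OF gd[OF c']])
  finally show ?thesis
    using D_chart_change[OF A c'(1) x(1) c'(2) sd[OF c'], of "\<xi> c x"]
      del_chart_change[OF A c'(1) x(1) c'(2) gd[OF c'] gd[OF A(2) x(1)], of "\<xi> c x"]
    by (simp add: \<xi>c o_def)
qed

lemma holomorphic_fun_on_cong:
  assumes S: "open S" and eq: "\<And>w. w \<in> S \<Longrightarrow> g w = f w" and f: "holomorphic_fun_on S f"
  shows "holomorphic_fun_on S g"
  unfolding holomorphic_fun_on_def
proof
  fix z assume z: "z \<in> S"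
  show "g differentiable (at z) \<and> (\<forall>v. D g z (J v) = \<i> * D g z v)"
    using f z D_cong_open[of S z g f, OF S z eq] by (simp add: holomorphic_fun_on_def)
qed

text \<open>
  The operator \<open>H + (\<i>/k) \<nabla>\<^sub>\<xi>\<close> without the projections.
\<close>

definition kostant ::
    "('p, 'm::finite) chart set \<Rightarrow> ('i, 'p) line_bundle \<Rightarrow> ('p \<Rightarrow> real) \<Rightarrow> ('p, 'm) vfield
      \<Rightarrow> nat \<Rightarrow> ('i, 'p) sec \<Rightarrow> ('i, 'p) sec"
  where
  "kostant A L H \<xi> k s =
     (\<lambda>i x. complex_of_real (H x) * s i x + \<i> / of_nat k * chern_derivative A L k \<xi> s i x)"

text \<open>
  The differential of \<open>s\<^sub>i = g\<^sup>k s\<^sub>j\<close> contains the term \<open>k g\<^sup>k s\<^sub>j dg/g\<close>.  It is cancelled by the change of the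
  connection form, because \<open>h\<^sub>j = |g|\<^sup>2 h\<^sub>i\<close> gives \<open>\<partial> log h\<^sub>j = dg/g + \<partial> log h\<^sub>i\<close>.
\<close>

lemma chern_derivative_transition:
  fixes A :: "('p::t2_space, 'm::finite) chart set"
  assumes A: "compact_complex_manifold A" and L: "hermitian_holomorphic_line_bundle A L"
    and \<xi>: "smooth_vector_field A \<xi>" and s: "s \<in> holomorphic_sections A L k"
    and ij: "i \<in> index L" "j \<in> index L" and x: "x \<in> triv L i" "x \<in> triv L j"
  shows "chern_derivative A L k \<xi> s i x = trans_fun L i j x ^ k * chern_derivative A L k \<xi> s j x"
proof -
  define c where "c = chart_at A x"
  have c: "c \<in> A" "x \<in> dom_ch c" using chart_at[OF A] by (auto simp: c_def)
  define z where "z = coord c x"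
  define V where "V = coord c ` (dom_ch c \<inter> (triv L i \<inter> triv L j))"
  have opV: "open V" unfolding V_def
    by (rule open_coord_image[OF A c(1)]) (intro open_Int line_bundle_facts(1)[OF L ij] line_bundle_facts(1)[OF L ij(2,1)])
  have zV: "z \<in> V" using x c by (auto simp: V_def z_def)
  have pz: "param c z = x" using chart_facts(3)[OF A c] by (simp add: z_def)
  have inV: "param c w \<in> triv L i" "param c w \<in> triv L j" if "w \<in> V" for w
    using coord_imageD[OF A c(1) that[unfolded V_def]] by auto
  define g where "g = (\<lambda>w. trans_fun L i j (param c w))"
  have hg: "holomorphic_fun_on V g"
    using line_bundle_facts(6)[OF L ij c(1)] by (simp add: V_def g_def o_def Int_assoc)
  have gd: "g differentiable (at z)" "D g z (J v) = \<i> * D g z v" for v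
    using hg zV by (auto simp: holomorphic_fun_on_def)
  have gnz: "g w \<noteq> 0" if "w \<in> V" for w
    using line_bundle_facts(3)[OF L ij] inV[OF that] by (simp add: g_def)
  have sec: "(s i \<circ> param c) w = g w ^ k * (s j \<circ> param c) w" if "w \<in> V" for w
  proof -
    have "s i (param c w) = trans_fun L i j (param c w) ^ k * s j (param c w)"
      using s ij inV[OF that] unfolding holomorphic_sections_def is_section_def by blast
    then show ?thesis by (simp add: g_def)
  qed
  have sd: "(s j \<circ> param c) differentiable (at z)"
    using s c ij x unfolding holomorphic_sections_def holomorphic_fun_on_def z_def by blast
  define v where "v = \<xi> c x"
  define l where "l = (\<lambda>i w. complex_of_real (ln (weight L i (param c w))))"
  have ld: "l a differentiable (at z)" if "a \<in> index L" "x \<in> triv L a" for a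
    unfolding l_def by (rule log_weight_twice_differentiable(1)[OF A c(1) L that(1)])
      (use c that in \<open>auto simp: z_def\<close>)
  have "l j w = complex_of_real (ln ((cmod (g w))\<^sup>2)) + l i w" if "w \<in> V" for w
  proof -
    have "weight L j (param c w) = (cmod (g w))\<^sup>2 * weight L i (param c w)" "weight L i (param c w) > 0"
      using line_bundle_facts(4)[OF L ij] line_bundle_facts(2)[OF L ij] inV[OF that] by (simp_all add: g_def)
    then show ?thesis using gnz[OF that] by (simp add: l_def ln_mult)
  qed
  then have "del (l j) z = del (\<lambda>w. complex_of_real (ln ((cmod (g w))\<^sup>2)) + l i w) z"
    by (rule del_cong_open[OF opV zV])
  then have dl: "del (l j) z v = D g z v / g z + del (l i) z v"
    by (simp add: del_add[OF del_ln_cmod_square(1)[OF gd gnz[OF zV]] ld[OF ij(1) x(1)]]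
        del_ln_cmod_square(2)[OF gd gnz[OF zV]])
  have "((\<lambda>w. g w ^ k * (s j \<circ> param c) w) has_derivative
      (\<lambda>v. g z ^ k * D (s j \<circ> param c) z v + (of_nat k * D g z v * g z ^ (k - 1)) * (s j \<circ> param c) z)) (at z)"
    by (intro has_derivative_mult has_derivative_power D_has_derivative gd sd)
  from D_eqI[OF this] have ds: "D (s i \<circ> param c) z v =
      g z ^ k * D (s j \<circ> param c) z v + (of_nat k * D g z v * g z ^ (k - 1)) * (s j \<circ> param c) z"
    using D_cong_open(1)[of V z "s i \<circ> param c" "\<lambda>w. g w ^ k * (s j \<circ> param c) w", OF opV zV sec] by simp
  have pow: "of_nat k * a * g z ^ (k - 1) = g z ^ k * of_nat k * (a / g z)" for a
    using gnz[OF zV] by (cases k) (auto simp: field_simps)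
  have cd: "chern_derivative A L k \<xi> s a x = D (s a \<circ> param c) z v + s a x * (of_nat k * del (l a) z v)"
    if "a \<in> index L" "x \<in> triv L a" for a
    using chern_derivative_in_chart[OF A c(1) L that(1) \<xi> s c(2) that(2)] by (simp add: z_def v_def l_def)
  have si: "s i x = g z ^ k * s j x" using sec[OF zV] by (simp add: pz)
  show ?thesis
    unfolding cd[OF ij(1) x(1)] cd[OF ij(2) x(2)] ds dl pow si
    by (simp add: pz g_def algebra_simps)
qed

text \<open>
  In a chart and a frame the operator reads \<open>f \<mapsto> P f + (\<i>/k) df(\<xi>)\<close> with
  \<open>P = H + \<i> \<partial> log h (\<xi>)\<close>: the factor \<open>k\<close> of the connection form of \<open>L\<^sup>k\<close> cancels against \<open>1/k\<close>.  Both summands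
  are holomorphic.
\<close>

lemma kostant_holomorphic:
  fixes A :: "('p::t2_space, 'm::finite) chart set"
  assumes K: "polarized_kaehler_manifold A L \<omega>" and H: "smooth_function A H"
    and ham: "hamiltonian_vector_field A \<omega> H \<xi>" and gen: "holomorphic_R_action_generator A \<xi>"
    and s: "s \<in> holomorphic_sections A L k" and k: "k \<ge> 1"
  shows "kostant A L H \<xi> k s \<in> holomorphic_sections A L k"
proof -
  have A: "compact_complex_manifold A" and L: "hermitian_holomorphic_line_bundle A L"
    and \<omega>: "\<And>c i x u v. c \<in> A \<Longrightarrow> i \<in> index L \<Longrightarrow> x \<in> dom_ch c \<inter> triv L i \<Longrightarrow>
      complex_of_real (\<omega> c x u v) =
          - \<i> * del_delbar (\<lambda>w. complex_of_real (ln (weight L i (param c w)))) (coord c x) u v"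
    using K by (auto simp: polarized_kaehler_manifold_def)
  have \<xi>: "smooth_vector_field A \<xi>"
    and dH: "\<And>c x Y. c \<in> A \<Longrightarrow> x \<in> dom_ch c \<Longrightarrow> D (H \<circ> param c) (coord c x) Y = \<omega> c x (\<xi> c x) Y"
    using ham by (auto simp: hamiltonian_vector_field_def)
  have sec: "is_section L k s" using s by (simp add: holomorphic_sections_def)
  have "is_section L k (kostant A L H \<xi> k s)"
    unfolding is_section_def
  proof (intro conjI ballI allI impI)
    fix i j x assume ij: "i \<in> index L" "j \<in> index L" and x: "x \<in> triv L i \<inter> triv L j"
    have "s i x = trans_fun L i j x ^ k * s j x" using sec ij x unfolding is_section_def by blast
    then show "kostant A L H \<xi> k s i x = trans_fun L i j x ^ k * kostant A L H \<xi> k s j x"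
      using chern_derivative_transition[OF A L \<xi> s ij] x by (simp add: kostant_def algebra_simps)
  next
    fix i x assume "i \<notin> index L \<or> x \<notin> triv L i"
    moreover from this have "s i x = 0" using sec unfolding is_section_def by blast
    ultimately show "kostant A L H \<xi> k s i x = 0"
      by (auto simp: kostant_def chern_derivative_def)
  qed
  moreover have "holomorphic_fun_on (coord c ` (dom_ch c \<inter> triv L i)) (kostant A L H \<xi> k s i \<circ> param c)"
    if c: "c \<in> A" and i: "i \<in> index L" for c i
  proof -
    define V where "V = coord c ` (dom_ch c \<inter> triv L i)"
    have opV: "open V" unfolding V_def
      by (rule open_coord_image[OF A c]) (rule line_bundle_facts(1)[OF L i i])
    have V: "w \<in> coord c ` dom_ch c" "param c w \<in> dom_ch c" "param c w \<in> triv L i" "coord c (param c w) = w"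
      if "w \<in> V" for w
      using coord_imageD[OF A c that[unfolded V_def]] by auto
    define f where "f = s i \<circ> param c"
    define X where "X = \<xi> c \<circ> param c"
    define \<phi> where "\<phi> = (\<lambda>w. complex_of_real (ln (weight L i (param c w))))"
    define P where "P = (\<lambda>w. complex_of_real ((H \<circ> param c) w) + \<i> * del \<phi> w (X w))"
    have hf: "holomorphic_fun_on V f"
      using s c i unfolding holomorphic_sections_def V_def f_def by blast
    have hX: "holomorphic_map_on V X"
      using holomorphic_generator[OF A c gen] V(1) unfolding holomorphic_map_on_def X_def by blast
    have hP: "holomorphic_fun_on V P"
      unfolding holomorphic_fun_on_def
    proof
      fix z assume z: "z \<in> V"
      have Hd: "(H \<circ> param c) differentiable (at z)"
        using H c V(1)[OF z] by (auto simp: smooth_function_def intro: smooth_on_differentiable)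
      have ham: "complex_of_real (D (H \<circ> param c) z Y) = - \<i> * del_delbar \<phi> z (X z) Y" for Y
        using dH[OF c V(2)[OF z], of Y] \<omega>[OF c i, of "param c z" "X z" Y] V[OF z] by (simp add: X_def \<phi>_def)
      have fd: "\<phi> differentiable (at w)" "(\<lambda>w. D \<phi> w v) differentiable (at w)" if "w \<in> V" for w v
        using log_weight_twice_differentiable[OF A c L i that[unfolded V_def]] by (auto simp: \<phi>_def)
      have X: "X differentiable (at z)" "\<And>v. D X z (J v) = J (D X z v)"
        using hX z by (auto simp: holomorphic_map_on_def)
      show "P differentiable at z \<and> (\<forall>v. D P z (J v) = \<i> * D P z v)"
        using moment_map_holomorphic[OF opV z fd(1) fd(2)[OF z] X Hd ham] by (auto simp: P_def)
    qed
    have eq: "(kostant A L H \<xi> k s i \<circ> param c) w = P w * f w + \<i> / of_nat k * D f w (X w)" if "w \<in> V" for w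
      using k chern_derivative_in_chart[OF A c L i \<xi> s V(2,3)[OF that]] V(4)[OF that]
      by (simp add: kostant_def P_def f_def X_def \<phi>_def field_simps)
    have hol: "holomorphic_fun_on V (\<lambda>w. P w * f w + \<i> / of_nat k * D f w (X w))"
      by (intro holomorphic_fun_on_add holomorphic_fun_on_mult hf hP holomorphic_fun_on_const
          holomorphic_fun_on_D_along[OF opV hf hX])
    show ?thesis
      using holomorphic_fun_on_cong[OF opV eq hol] by (simp only: V_def)
  qed
  ultimately show ?thesis by (simp add: holomorphic_sections_def)
qed

section \<open>The orthogonal projection on holomorphic sections\<close>

lemma chosen_frame:
  assumes "hermitian_holomorphic_line_bundle A L"
  shows "(SOME i. i \<in> index L \<and> x \<in> triv L i) \<in> index L" "x \<in> triv L (SOME i. i \<in> index L \<and> x \<in> triv L i)"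
proof -
  have "(\<Union>i\<in>index L. triv L i) = UNIV" using assms unfolding hermitian_holomorphic_line_bundle_def by (elim conjE)
  then have "\<exists>i. i \<in> index L \<and> x \<in> triv L i" by blast
  from someI_ex[OF this]
  show "(SOME i. i \<in> index L \<and> x \<in> triv L i) \<in> index L" "x \<in> triv L (SOME i. i \<in> index L \<and> x \<in> triv L i)"
    by auto
qed

lemma hprod_in_frame:
  assumes L: "hermitian_holomorphic_line_bundle A L" and s: "is_section L k s" and t: "is_section L k t"
    and i: "i \<in> index L" "x \<in> triv L i"
  shows "hprod L k s t x = complex_of_real (weight L i x ^ k) * s i x * cnj (t i x)"
proof -
  define j where "j = (SOME i. i \<in> index L \<and> x \<in> triv L i)"
  have j: "j \<in> index L" "x \<in> triv L j" using chosen_frame[OF L] by (auto simp: j_def)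
  define g where "g = trans_fun L j i x"
  have st: "s j x = g ^ k * s i x" "t j x = g ^ k * t i x"
    using s t i j unfolding is_section_def g_def by blast+
  have w: "complex_of_real (weight L i x) = g * cnj g * complex_of_real (weight L j x)"
    using line_bundle_facts(4)[OF L j(1) i(1), of x] i j complex_norm_square[of g] by (simp add: g_def)
  have "hprod L k s t x = complex_of_real (weight L j x) ^ k * s j x * cnj (t j x)"
    by (simp add: hprod_def j_def Let_def)
  also have "\<dots> = complex_of_real (weight L i x) ^ k * s i x * cnj (t i x)"
    by (simp add: st w power_mult_distrib)
  finally show ?thesis by simp
qed

lemma continuous_on_from_chart:
  assumes A: "compact_complex_manifold A" "c \<in> A" and q: "continuous_on (coord c ` (dom_ch c \<inter> V)) (q \<circ> param c)"
  shows "continuous_on (dom_ch c \<inter> V) q"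
proof -
  have "continuous_on (dom_ch c \<inter> V) (\<lambda>x. (q \<circ> param c) (coord c x))"
    by (rule continuous_on_compose2[OF q continuous_on_subset[OF chart_facts(6)[OF A]]]) auto
  then show ?thesis
    by (rule continuous_on_eq) (use chart_facts(3)[OF A] in auto)
qed

lemma continuous_on_hprod:
  fixes A :: "('p::t2_space, 'm::finite) chart set"
  assumes A: "compact_complex_manifold A" and L: "hermitian_holomorphic_line_bundle A L"
    and s: "s \<in> holomorphic_sections A L k" and t: "t \<in> holomorphic_sections A L k"
  shows "continuous_on UNIV (hprod L k s t)"
proof (rule continuous_at_imp_continuous_on, rule ballI)
  fix x
  define i where "i = (SOME i. i \<in> index L \<and> x \<in> triv L i)"
  have i: "i \<in> index L" "x \<in> triv L i" using chosen_frame[OF L] by (auto simp: i_def)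
  define c where "c = chart_at A x"
  have c: "c \<in> A" "x \<in> dom_ch c" using chart_at[OF A] by (auto simp: c_def)
  have op: "open (dom_ch c \<inter> triv L i)"
    by (intro open_Int chart_facts(1)[OF A c(1)] line_bundle_facts(1)[OF L i(1) i(1)])
  have sec: "is_section L k s" "is_section L k t" using s t by (auto simp: holomorphic_sections_def)
  have cont: "continuous_on (dom_ch c \<inter> triv L i) (u i)" if "u \<in> holomorphic_sections A L k" for u
    by (rule continuous_on_from_chart[OF A c(1)], rule holomorphic_fun_on_continuous_on)
       (use that c i in \<open>auto simp: holomorphic_sections_def\<close>)
  have contw: "continuous_on (dom_ch c \<inter> triv L i) (weight L i)"
    using line_bundle_facts(5)[OF L i(1) i(1) c(1)] smooth_on_differentiable
    by (intro continuous_on_from_chart[OF A c(1)] continuous_at_imp_continuous_on ballI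
        differentiable_imp_continuous_within) blast
  have "continuous_on (dom_ch c \<inter> triv L i) (\<lambda>x. complex_of_real (weight L i x ^ k) * s i x * cnj (t i x))"
    by (intro continuous_intros cont s t contw)
  then have "continuous_on (dom_ch c \<inter> triv L i) (hprod L k s t)"
    by (rule continuous_on_eq) (use hprod_in_frame[OF L sec i(1)] in auto)
  then show "isCont (hprod L k s t) x"
    using op i c by (simp add: continuous_on_eq_continuous_at)
qed

text \<open>
  A section of nonzero norm is square integrable, since the integral of a function that is not integrable
  is \<open>0\<close> by convention.  The mixed product is dominated by \<open>|s| |t| \<le> |s|\<^sup>2 + |t|\<^sup>2\<close>.
\<close>

lemma integrable_hprod:
  fixes A :: "('p::t2_space, 'm::finite) chart set"
  assumes A: "compact_complex_manifold A" and L: "hermitian_holomorphic_line_bundle A L"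
    and vol: "sets vol = sets borel"
    and s: "s \<in> holomorphic_sections A L k" "L2_inner L vol k s s \<noteq> 0"
    and t: "t \<in> holomorphic_sections A L k" "L2_inner L vol k t t \<noteq> 0"
  shows "integrable vol (hprod L k s t)"
proof (rule Bochner_Integration.integrable_bound)
  have "integrable vol (hprod L k s s)" "integrable vol (hprod L k t t)"
    using s(2) t(2) unfolding L2_inner_def by (metis not_integrable_integral_eq)+
  then show "integrable vol (\<lambda>x. norm (hprod L k s s x) + norm (hprod L k t t x))"
    by auto
  show "hprod L k s t \<in> borel_measurable vol"
    using borel_measurable_continuous_onI[OF continuous_on_hprod[OF A L s(1) t(1)]]
      measurable_cong_sets[OF vol refl] by blast
  have "norm (hprod L k s t x) \<le> norm (hprod L k s s x) + norm (hprod L k t t x)" for x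
  proof -
    define i where "i = (SOME i. i \<in> index L \<and> x \<in> triv L i)"
    define W where "W = \<bar>weight L i x ^ k\<bar>"
    define a where "a = cmod (s i x)"
    define b where "b = cmod (t i x)"
    have "a * b \<le> a * a + b * b"
    proof -
      have "0 \<le> a * b" by (simp add: a_def b_def)
      then show ?thesis using sum_squares_bound[of a b] unfolding power2_eq_square by linarith
    qed
    then have "W * (a * b) \<le> W * (a * a + b * b)" by (rule mult_left_mono) (simp add: W_def)
    then show ?thesis
      by (simp add: hprod_def Let_def i_def[symmetric] norm_mult W_def a_def b_def distrib_left mult.assoc power_abs norm_power)
  qed
  then show "AE x in vol. norm (hprod L k s t x) \<le> norm (norm (hprod L k s s x) + norm (hprod L k t t x))"
    by auto
qed

text \<open>
  The only issue is the uniqueness of the section singled out by the projection.  If \<open>s - t\<close> is orthogonal to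
  the members of the orthonormal basis, then \<open>s\<close> and \<open>t\<close> have the same coefficients.
\<close>

lemma szego_projection_holomorphic:
  fixes A :: "('p::t2_space, 'm::finite) chart set"
  assumes A: "compact_complex_manifold A" and L: "hermitian_holomorphic_line_bundle A L"
    and vol: "sets vol = sets borel" and e: "eigenbasis A L vol H \<xi> k N \<mu> e"
    and s: "s \<in> holomorphic_sections A L k"
  shows "szego_projection A L vol k s = s"
  unfolding szego_projection_def
proof (rule the_equality)
  show "s \<in> holomorphic_sections A L k \<and> (\<forall>u\<in>holomorphic_sections A L k. L2_inner L vol k (\<lambda>i x. s i x - s i x) u = 0)"
    using s by (simp add: L2_inner_def hprod_def)
  have eh: "\<And>j. j \<in> {1..N} \<Longrightarrow> e j \<in> holomorphic_sections A L k"
    and orth: "\<And>j l. j \<in> {1..N} \<Longrightarrow> l \<in> {1..N} \<Longrightarrow> L2_inner L vol k (e j) (e l) = (if j = l then 1 else 0)"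
    and span: "\<And>t. t \<in> holomorphic_sections A L k \<Longrightarrow> \<exists>a. t = (\<lambda>i x. \<Sum>j=1..N. a j * e j i x)"
    using e unfolding eigenbasis_def by blast+
  fix t assume t: "t \<in> holomorphic_sections A L k \<and> (\<forall>u\<in>holomorphic_sections A L k. L2_inner L vol k (\<lambda>i x. s i x - t i x) u = 0)"
  obtain a where a: "s = (\<lambda>i x. \<Sum>j=1..N. a j * e j i x)" using span[OF s] by blast
  obtain b where b: "t = (\<lambda>i x. \<Sum>j=1..N. b j * e j i x)" using span t by blast
  have "a l = b l" if l: "l \<in> {1..N}" for l
  proof -
    have int: "integrable vol (hprod L k (e j) (e l))" if "j \<in> {1..N}" for j
      by (rule integrable_hprod[OF A L vol eh[OF that] _ eh[OF l]]) (simp_all only: orth[OF that that] orth[OF l l], simp_all)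
    have "hprod L k (\<lambda>i x. s i x - t i x) (e l) = (\<lambda>x. \<Sum>j=1..N. (a j - b j) * hprod L k (e j) (e l) x)"
    proof
      fix x
      have "s i x - t i x = (\<Sum>j=1..N. (a j - b j) * e j i x)" for i
        by (simp add: a b sum_subtractf left_diff_distrib)
      then show "hprod L k (\<lambda>i x. s i x - t i x) (e l) x = (\<Sum>j=1..N. (a j - b j) * hprod L k (e j) (e l) x)"
        by (simp add: hprod_def Let_def sum_distrib_left sum_distrib_right mult_ac)
    qed
    then have "L2_inner L vol k (\<lambda>i x. s i x - t i x) (e l) = (\<integral>x. (\<Sum>j=1..N. (a j - b j) * hprod L k (e j) (e l) x) \<partial>vol)"
      by (simp add: L2_inner_def)
    also have "\<dots> = (\<Sum>j=1..N. (a j - b j) * L2_inner L vol k (e j) (e l))"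
      using int by (subst Bochner_Integration.integral_sum) (auto simp: L2_inner_def)
    also have "\<dots> = (\<Sum>j=1..N. if j = l then a j - b j else 0)"
      by (intro sum.cong) (use orth l in auto)
    also have "\<dots> = a l - b l" using l by simp
    finally show ?thesis using t eh[OF l] by simp
  qed
  then show "t = s" unfolding a b by (intro ext sum.cong) auto
qed

text \<open>
  On a holomorphic section the inner projection acts as the identity, and so does the outer one because the
  Kostant operator preserves holomorphy.
\<close>

lemma toeplitz_eq_kostant:
  fixes A :: "('p::t2_space, 'm::finite) chart set"
  assumes K: "polarized_kaehler_manifold A L \<omega>" and vol: "liouville_measure A \<omega> vol"
    and H: "smooth_function A H"
    and ham: "hamiltonian_vector_field A \<omega> H \<xi>" and gen: "holomorphic_R_action_generator A \<xi>"
    and e: "eigenbasis A L vol H \<xi> k N \<mu> e" and k: "k \<ge> 1"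
    and s: "s \<in> holomorphic_sections A L k"
  shows "toeplitz A L vol H \<xi> k s = kostant A L H \<xi> k s"
proof -
  have A: "compact_complex_manifold A" and L: "hermitian_holomorphic_line_bundle A L"
    using K by (auto simp: polarized_kaehler_manifold_def)
  have vol': "sets vol = sets borel" using vol by (simp add: liouville_measure_def)
  note proj = szego_projection_holomorphic[OF A L vol' e]
  have "toeplitz A L vol H \<xi> k s = szego_projection A L vol k (kostant A L H \<xi> k s)"
    by (simp add: toeplitz_def proj[OF s] Let_def kostant_def)
  then show ?thesis by (simp add: proj[OF kostant_holomorphic[OF K H ham gen s k]])
qed

section \<open>Eigensections at critical points\<close>

text \<open>
  Nondegeneracy of \<open>\<omega>\<close> in the form of its positivity: \<open>0 = dH(J \<xi>) = \<omega>(\<xi>, J \<xi>)\<close>.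
\<close>

lemma vector_field_zero_at_critical_point:
  assumes K: "polarized_kaehler_manifold A L \<omega>" and ham: "hamiltonian_vector_field A \<omega> H \<xi>"
    and crit: "\<And>v. D (H \<circ> param c) (coord c z) v = 0" and c: "c \<in> A" "z \<in> dom_ch c"
  shows "\<xi> c z = 0"
proof (rule ccontr)
  assume "\<xi> c z \<noteq> 0"
  then have "\<omega> c z (\<xi> c z) (J (\<xi> c z)) > 0" using K c unfolding polarized_kaehler_manifold_def by blast
  moreover have "D (H \<circ> param c) (coord c z) (J (\<xi> c z)) = \<omega> c z (\<xi> c z) (J (\<xi> c z))"
    using ham c unfolding hamiltonian_vector_field_def by blast
  ultimately show False using crit by simp
qed

lemma kostant_at_zero:
  fixes A :: "('p::t2_space, 'm::finite) chart set"
  assumes A: "compact_complex_manifold A" and L: "hermitian_holomorphic_line_bundle A L"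
    and \<xi>: "smooth_vector_field A \<xi>" and s: "s \<in> holomorphic_sections A L k"
    and c: "c \<in> A" "z \<in> dom_ch c" "\<xi> c z = 0" and i: "i \<in> index L" "z \<in> triv L i"
  shows "kostant A L H \<xi> k s i z = complex_of_real (H z) * s i z"
proof -
  have "(s i \<circ> param c) differentiable (at (coord c z))"
    using s c i unfolding holomorphic_sections_def holomorphic_fun_on_def by blast
  from linear_0[OF D_linear[OF this]] show ?thesis
    using chern_derivative_in_chart[OF A c(1) L i(1) \<xi> s c(2) i(2)]
    by (simp add: kostant_def c(3) del_def)
qed

text \<open>
  At the critical point the eigenvalue equation becomes \<open>\<mu>\<^sub>j s\<^sub>j(z) = H(z) s\<^sub>j(z)\<close>.
\<close>

lemma eigensection_vanishes:
  fixes A :: "('p::t2_space, 'm::finite) chart set"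
  assumes K: "polarized_kaehler_manifold A L \<omega>" and vol: "liouville_measure A \<omega> vol"
    and H: "smooth_function A H"
    and ham: "hamiltonian_vector_field A \<omega> H \<xi>" and gen: "holomorphic_R_action_generator A \<xi>"
    and e: "eigenbasis A L vol H \<xi> k N \<mu> e" and k: "k \<ge> 1"
    and crit: "\<And>c v. c \<in> A \<Longrightarrow> z \<in> dom_ch c \<Longrightarrow> D (H \<circ> param c) (coord c z) v = 0"
    and j: "j \<in> {1..N}" "\<mu> j \<noteq> H z"
  shows "hnorm L k (e j) z = 0"
proof -
  have A: "compact_complex_manifold A" and L: "hermitian_holomorphic_line_bundle A L"
    using K by (auto simp: polarized_kaehler_manifold_def)
  have \<xi>: "smooth_vector_field A \<xi>" using ham by (simp add: hamiltonian_vector_field_def)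
  define c where "c = chart_at A z"
  have c: "c \<in> A" "z \<in> dom_ch c" using chart_at[OF A] by (auto simp: c_def)
  have c0: "\<xi> c z = 0" by (rule vector_field_zero_at_critical_point[OF K ham crit[OF c] c])
  define i where "i = (SOME i. i \<in> index L \<and> z \<in> triv L i)"
  have i: "i \<in> index L" "z \<in> triv L i" using chosen_frame[OF L] by (auto simp: i_def)
  have ej: "e j \<in> holomorphic_sections A L k"
    and ev: "toeplitz A L vol H \<xi> k (e j) = (\<lambda>i x. complex_of_real (\<mu> j) * e j i x)"
    using e j(1) unfolding eigenbasis_def by blast+
  have "complex_of_real (\<mu> j) * e j i z = kostant A L H \<xi> k (e j) i z"
    using fun_cong[OF fun_cong[OF ev]] toeplitz_eq_kostant[OF K vol H ham gen e k ej] by simp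
  also have "\<dots> = complex_of_real (H z) * e j i z"
    by (rule kostant_at_zero[OF A L \<xi> ej c c0 i])
  finally have "e j i z = 0" using j(2) by simp
  then show ?thesis by (simp add: hnorm_def hprod_def i_def Let_def)
qed

lemma pointwise_spectral_measure_eq_return:
  assumes "\<And>j. j \<in> {1..N} \<Longrightarrow> \<mu> j \<noteq> E \<Longrightarrow> hnorm L k (s j) z = 0" and nz: "bergman L k N s z \<noteq> 0"
  shows "pointwise_spectral_measure L k N \<mu> s z = return borel E"
proof -
  define b where "b = bergman L k N s z"
  have b: "b > 0" using nz by (simp add: b_def bergman_def less_le sum_nonneg)
  have "(\<Sum>j=1..N. ennreal ((hnorm L k (s j) z)\<^sup>2 / b) * emeasure (return borel (\<mu> j)) B) = indicator B E"
    if B: "B \<in> sets borel" for B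
  proof -
    have "(\<Sum>j=1..N. ennreal ((hnorm L k (s j) z)\<^sup>2 / b) * emeasure (return borel (\<mu> j)) B) =
        (\<Sum>j=1..N. ennreal ((hnorm L k (s j) z)\<^sup>2 / b) * indicator B E)"
    proof (rule sum.cong[OF refl])
      fix j assume "j \<in> {1..N}"
      then show "ennreal ((hnorm L k (s j) z)\<^sup>2 / b) * emeasure (return borel (\<mu> j)) B =
          ennreal ((hnorm L k (s j) z)\<^sup>2 / b) * indicator B E"
        using assms(1)[of j] B by (cases "\<mu> j = E") auto
    qed
    also have "\<dots> = (\<Sum>j=1..N. ennreal ((hnorm L k (s j) z)\<^sup>2 / b)) * indicator B E"
      by (simp add: sum_distrib_right)
    also have "(\<Sum>j=1..N. ennreal ((hnorm L k (s j) z)\<^sup>2 / b)) = ennreal (\<Sum>j=1..N. (hnorm L k (s j) z)\<^sup>2 / b)"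
      using b by (intro sum_ennreal) auto
    also have "(\<Sum>j=1..N. (hnorm L k (s j) z)\<^sup>2 / b) = 1"
      using b by (simp add: sum_divide_distrib[symmetric] b_def bergman_def)
    finally show ?thesis by simp
  qed
  then show ?thesis
    unfolding pointwise_spectral_measure_def return_def space_borel b_def[symmetric]
    by (intro measure_of_eq) (auto simp: sets.sigma_sets_eq[of borel, simplified])
qed

lemma partial_bergman_eq:
  assumes "\<And>j. j \<in> {1..N} \<Longrightarrow> \<mu> j \<noteq> E \<Longrightarrow> hnorm L k (s j) z = 0"
  shows "partial_bergman L k N \<mu> s I z = (if E \<in> I then bergman L k N s z else 0)"
proof (cases "E \<in> I")
  case True
  have "(hnorm L k (s j) z)\<^sup>2 = 0" if "j \<in> {1..N} - {j. j \<in> {1..N} \<and> \<mu> j \<in> I}" for j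
  proof -
    have "\<mu> j \<noteq> E" using that True by auto
    then show ?thesis using assms that by simp
  qed
  then show ?thesis
    unfolding partial_bergman_def bergman_def if_P[OF True] by (intro sum.mono_neutral_left) auto
next
  case False
  then show ?thesis
    unfolding partial_bergman_def if_not_P[OF False] by (intro sum.neutral) (use assms in auto)
qed

theorem proposition1p4:
  fixes A :: "('p::t2_space, 'm::finite) chart set"
    and L :: "('i, 'p) line_bundle"
    and \<omega> :: "('p, 'm) two_form"
    and vol :: "'p measure"
    and H :: "'p \<Rightarrow> real"
    and \<xi> :: "('p, 'm) vfield"
    and N :: "nat \<Rightarrow> nat"
    and \<mu> :: "nat \<Rightarrow> nat \<Rightarrow> real"
    and s :: "nat \<Rightarrow> nat \<Rightarrow> ('i, 'p) sec"
    and z\<^sub>c :: 'p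
    and E :: real
  assumes "polarized_kaehler_manifold A L \<omega>"
    and "liouville_measure A \<omega> vol"
    and "smooth_function A H"
    and "hamiltonian_vector_field A \<omega> H \<xi>"
    and "holomorphic_R_action_generator A \<xi>"
    and "\<And>k. k \<ge> 1 \<Longrightarrow> eigenbasis A L vol H \<xi> k (N k) (\<mu> k) (s k)"
    and "morse_critical_point A H z\<^sub>c"
    and "E = H z\<^sub>c"
  shows "(\<forall>k\<ge>1. bergman L k (N k) (s k) z\<^sub>c \<noteq> 0 \<longrightarrow>
            pointwise_spectral_measure L k (N k) (\<mu> k) (s k) z\<^sub>c = return borel (H z\<^sub>c)) \<and>
         (\<forall>I :: real set. is_interval I \<longrightarrow>
            ((\<lambda>k. partial_bergman L k (N k) (\<mu> k) (s k) I z\<^sub>c / bergman L k (N k) (s k) z\<^sub>c)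
               \<longlongrightarrow> (if E \<in> I then 1 else 0))
              (inf sequentially (principal {k. bergman L k (N k) (s k) z\<^sub>c \<noteq> 0})))"
proof -
  have van: "hnorm L k (s k j) z\<^sub>c = 0" if "k \<ge> 1" "j \<in> {1..N k}" "\<mu> k j \<noteq> H z\<^sub>c" for k j
    by (rule eigensection_vanishes[OF assms(1-5) assms(6)[OF that(1)] that(1) _ that(2,3)])
       (use assms(7) in \<open>auto simp: morse_critical_point_def\<close>)
  have "\<forall>\<^sub>F k in inf sequentially (principal {k. bergman L k (N k) (s k) z\<^sub>c \<noteq> 0}).
      partial_bergman L k (N k) (\<mu> k) (s k) I z\<^sub>c / bergman L k (N k) (s k) z\<^sub>c = (if E \<in> I then 1 else 0)" for I
    unfolding eventually_inf_principal
    by (rule eventually_mono[OF eventually_ge_at_top[of 1]])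
       (use partial_bergman_eq[OF van] assms(8) in auto)
  then have "((\<lambda>k. partial_bergman L k (N k) (\<mu> k) (s k) I z\<^sub>c / bergman L k (N k) (s k) z\<^sub>c)
      \<longlongrightarrow> (if E \<in> I then 1 else 0)) (inf sequentially (principal {k. bergman L k (N k) (s k) z\<^sub>c \<noteq> 0}))" for I
    by (rule tendsto_eventually)
  moreover have "pointwise_spectral_measure L k (N k) (\<mu> k) (s k) z\<^sub>c = return borel (H z\<^sub>c)"
    if "k \<ge> 1" "bergman L k (N k) (s k) z\<^sub>c \<noteq> 0" for k
    by (rule pointwise_spectral_measure_eq_return[OF van[OF that(1)] that(2)])
  ultimately show ?thesis by blast
qed

end
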